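(* Let $G$ be a finite connected bridgeless planar trivalent graph, embedded in the plane, of order $n\geq 4$ (i.e. with $n$ vertices), and having $m$ regions (including the unbounded one). Let $s(G)$ be the number of non-equivalent states of $G$, i.e. the number of equivalence classes of states under region crossing changes. Let $\phi:\mathcal{G}\to S_3$ be the coloring monodromy of $G$ (defined when $G$ has odd regions but no two adjacent odd regions) and let $\mathcal{H}=\{e,(13)\}\subset S_3$. Then $$s(G)=\begin{cases}2^{n-m+2} & \text{if all the regions are even;}\\ 2^{n-m+1} & \text{if there exist odd regions but no adjacent odd regions, and } \phi(\mathcal{G})\subseteq\mathcal{H};\\ 2^{n-m} & \text{otherwise.}\end{cases}$$
   Context: Graphs may have multiple edges. A graph is trivalent if every vertex has degree $3$. Since $G$ is connected and bridgeless, it is loopless and the three regions around each vertex are mutually distinct, so each region is a $k$-gon for some positive integer $k$; the region is called even if $k$ is even and odd if $k$ is odd. Two regions are adjacent if they share an edge. States: a state of $G$ is a function $s:V(G)\to\{0,1\}$. A region crossing change on a region $R$ changes a state by switching (replacing $0$ by $1$ and $1$ by $0$) the value $s(v)$ at every vertex $v$ lying on the boundary of $R$, leaving the other values unchanged. Two states are equivalent if they are related by a finite sequence of region crossing changes. Dual triangulation: view the plane as part of $S^2$. The dual graph $G'$ is a triangulation of $S^2$ (possibly with multiple edges) whose vertices correspond to regions of $G$ and whose triangles correspond to vertices of $G$; a region of $G$ is odd iff the corresponding vertex of $G'$ has odd degree (is an odd vertex). Two triangles are adjacent if they share an edge. Coloring monodromy: suppose $G$ has odd regions, and no two odd regions are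 adjacent. Let $R_1,\dots,R_k$ be the odd regions and $v_1',\dots,v_k'$ the corresponding (odd) vertices of $G'$. Choose a vertex $v_1$ of $G$ on the boundary of $R_1$, and let $\Delta$ be the triangle of $G'$ dual to $v_1$; thus $v_1'$ is a vertex of $\Delta$ and the other two vertices of $\Delta$ are even. Color the three vertices of $\Delta$ bijectively by the colors $1,2,3$ such that $v_1'$ has color $2$. If a triangle has its three vertices colored by the three distinct colors $1,2,3$, then there is a unique way to color an adjacent triangle with three distinct colors that agrees on the two vertices of the shared edge; hence along any sequence of successively adjacent triangles a coloring of the first triangle induces a unique coloring of the last one. A closed walk in $G$ beginning and ending at $v_1$ corresponds to a sequence of successively adjacent triangles beginning and ending at $\Delta$, and so induces a recoloring of $\Delta$, i.e. a permutation in $S_3$ of the colors $\{1,2,3\}$ (describing how the new colors of the vertices of $\Delta$ are obtained from the original ones). The recoloring is unchanged when the sequence of triangles is slid over an even vertex of $G'$, so it depends only on the homotopy class of the closed walk in $S^2\setminus\{v_1',\dots,v_k'\}$. This defines the coloring monodromy, a group homomorphism $\phi:\mathcal{G}=\pi_1(S^2\setminus\{v_1',\dots,v_k'\})\to S_3$ (with base point in $\Delta$). The condition $\phi(\mathcal{G})\subseteq\mathcal{H}=\{e,(13)\}$ says that every such recoloring assigns color $2$ to $v_1'$ again. *)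

theory Defs
  imports "HOL-Analysis.Analysis" "HOL-Combinatorics.Permutations"
begin

section \<open>Plane multigraphs\<close>

text \<open>
  A graph embedded in the plane is given by its finite vertex set \<open>V\<close> of points and its finite set
  \<open>E\<close> of edges, each edge being a point set (the image of a simple path).  Parallel edges are
  different point sets with the same ends.  Loops are simple closed curves and are not excluded.
  The ends of \<open>e\<close> are the members of \<open>e \<inter> V\<close>.
\<close>

definition plane_graph :: "complex set \<Rightarrow> complex set set \<Rightarrow> bool" where
  "plane_graph V E \<longleftrightarrow>
     finite V \<and> finite E \<and>
     (\<forall>e\<in>E. \<exists>g. simple_path g \<and> path_image g = e \<and> e \<inter> V = {pathstart g, pathfinish g}) \<and>
     (\<forall>e\<in>E. \<forall>f\<in>E. e \<noteq> f \<longrightarrow> e \<inter> f \<subseteq> V)"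

text \<open>The second summand makes loops count twice.\<close>

definition degree :: "complex set \<Rightarrow> complex set set \<Rightarrow> complex \<Rightarrow> nat" where
  "degree V E v = card {e \<in> E. v \<in> e} + card {e \<in> E. e \<inter> V = {v}}"

definition trivalent :: "complex set \<Rightarrow> complex set set \<Rightarrow> bool" where
  "trivalent V E \<longleftrightarrow> (\<forall>v\<in>V. degree V E v = 3)"

fun walk :: "complex set \<Rightarrow> complex set set \<Rightarrow> complex \<Rightarrow> complex set list \<Rightarrow> complex \<Rightarrow> bool" where
  "walk V E v [] w \<longleftrightarrow> v \<in> V \<and> v = w"
| "walk V E v (e # es) w \<longleftrightarrow> e \<in> E \<and> (\<exists>x. e \<inter> V = {v, x} \<and> walk V E x es w)"

definition graph_connected :: "complex set \<Rightarrow> complex set set \<Rightarrow> bool" where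
  "graph_connected V E \<longleftrightarrow> V \<noteq> {} \<and> (\<forall>v\<in>V. \<forall>w\<in>V. \<exists>es. walk V E v es w)"

definition bridge :: "complex set \<Rightarrow> complex set set \<Rightarrow> complex set \<Rightarrow> bool" where
  "bridge V E e \<longleftrightarrow>
     e \<in> E \<and> (\<exists>v w. e \<inter> V = {v, w} \<and> \<not> (\<exists>es. walk V (E - {e}) v es w))"

definition bridgeless :: "complex set \<Rightarrow> complex set set \<Rightarrow> bool" where
  "bridgeless V E \<longleftrightarrow> (\<forall>e\<in>E. \<not> bridge V E e)"

section \<open>Regions\<close>

definition regions :: "complex set \<Rightarrow> complex set set \<Rightarrow> complex set set" where
  "regions V E = components (- (V \<union> \<Union>E))"

text \<open>A region is a \<open>k\<close>-gon for \<open>k\<close> the number of edges on its boundary.\<close>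

definition sides :: "complex set set \<Rightarrow> complex set \<Rightarrow> nat" where
  "sides E R = card {e \<in> E. e \<subseteq> frontier R}"

definition odd_region :: "complex set set \<Rightarrow> complex set \<Rightarrow> bool" where
  "odd_region E R \<longleftrightarrow> odd (sides E R)"

definition adjacent_regions :: "complex set set \<Rightarrow> complex set \<Rightarrow> complex set \<Rightarrow> bool" where
  "adjacent_regions E R R' \<longleftrightarrow> R \<noteq> R' \<and> (\<exists>e\<in>E. e \<subseteq> frontier R \<and> e \<subseteq> frontier R')"

definition adjacent_odd_regions :: "complex set \<Rightarrow> complex set set \<Rightarrow> bool" where
  "adjacent_odd_regions V E \<longleftrightarrow>
     (\<exists>R\<in>regions V E. \<exists>R'\<in>regions V E.
        odd_region E R \<and> odd_region E R' \<and> adjacent_regions E R R')"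

section \<open>States and region crossing changes\<close>

definition states :: "complex set \<Rightarrow> (complex \<Rightarrow> nat) set" where
  "states V = V \<rightarrow>\<^sub>E {0, 1}"

definition crossing_change :: "complex set \<Rightarrow> complex set \<Rightarrow> (complex \<Rightarrow> nat) \<Rightarrow> (complex \<Rightarrow> nat)" where
  "crossing_change V R s = (\<lambda>v. if v \<in> V \<inter> frontier R then 1 - s v else s v)"

definition state_equiv ::
  "complex set \<Rightarrow> complex set set \<Rightarrow> ((complex \<Rightarrow> nat) \<times> (complex \<Rightarrow> nat)) set" where
  "state_equiv V E =
     {(s, t). s \<in> states V \<and> t \<in> states V \<and>
              (s, t) \<in> {(a, crossing_change V R a) | a R. R \<in> regions V E}\<^sup>*}"

definition num_states :: "complex set \<Rightarrow> complex set set \<Rightarrow> nat" where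
  "num_states V E = card (states V // state_equiv V E)"

section \<open>Coloring monodromy\<close>

text \<open>
  The vertices of the dual triangulation are the regions.  The triangle dual to \<open>v\<close> has as its
  vertices the regions around \<open>v\<close>, and crossing from one triangle to an adjacent one means
  traversing an edge \<open>e\<close> of the graph; the vertices of the shared side are the two regions with
  \<open>e\<close> on their boundary.
\<close>

definition triangle :: "complex set \<Rightarrow> complex set set \<Rightarrow> complex \<Rightarrow> complex set set" where
  "triangle V E v = {R \<in> regions V E. v \<in> frontier R}"

definition triangle_coloring ::
  "complex set \<Rightarrow> complex set set \<Rightarrow> complex \<Rightarrow> (complex set \<Rightarrow> nat) \<Rightarrow> bool" where
  "triangle_coloring V E v c \<longleftrightarrow> bij_betw c (triangle V E v) {1, 2, 3}"

text \<open>
  \<open>induces V E v c es w d\<close>: \<open>es\<close> is a walk from \<open>v\<close> to \<open>w\<close> along which the coloring \<open>c\<close> of the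
  triangle of \<open>v\<close> induces the coloring \<open>d\<close> of the triangle of \<open>w\<close>.
  Only the values of a coloring on the triangle concerned are relevant.
\<close>

inductive induces ::
  "complex set \<Rightarrow> complex set set \<Rightarrow> complex \<Rightarrow> (complex set \<Rightarrow> nat) \<Rightarrow> complex set list \<Rightarrow>
   complex \<Rightarrow> (complex set \<Rightarrow> nat) \<Rightarrow> bool"
  for V E where
  Nil: "v \<in> V \<Longrightarrow> triangle_coloring V E v c \<Longrightarrow> induces V E v c [] v c"
| Cons: "e \<in> E \<Longrightarrow> e \<inter> V = {v, x} \<Longrightarrow>
     triangle_coloring V E v c \<Longrightarrow> triangle_coloring V E x c' \<Longrightarrow>
     (\<And>R. R \<in> regions V E \<Longrightarrow> e \<subseteq> frontier R \<Longrightarrow> c' R = c R) \<Longrightarrow>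
     induces V E x c' es w d \<Longrightarrow> induces V E v c (e # es) w d"

definition closed_walks :: "complex set \<Rightarrow> complex set set \<Rightarrow> complex \<Rightarrow> complex set list set" where
  "closed_walks V E v = {es. walk V E v es v}"

text \<open>
  The monodromy sends a closed walk at \<open>v\<close> to the permutation of the colors that takes the old
  color (under \<open>c\<close>) of each vertex of the base triangle to its new color.  If the odd regions are
  pairwise non-adjacent, this only depends on the homotopy class of the walk in the sphere punctured
  in the odd regions.  Every homotopy class of loops at \<open>v\<close> there contains a closed walk, so the
  image of the fundamental group is the image of \<open>closed_walks V E v\<close>.
\<close>

definition coloring_monodromy ::
  "complex set \<Rightarrow> complex set set \<Rightarrow> complex \<Rightarrow> (complex set \<Rightarrow> nat) \<Rightarrow> complex set list \<Rightarrow>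
   (nat \<Rightarrow> nat)" where
  "coloring_monodromy V E v c es =
     (THE p. p permutes {1, 2, 3} \<and>
        (\<exists>d. induces V E v c es v d \<and> (\<forall>R\<in>triangle V E v. d R = p (c R))))"

text \<open>The choice of an odd region, a vertex on its boundary and an initial coloring.\<close>

definition monodromy_base ::
  "complex set \<Rightarrow> complex set set \<Rightarrow> complex set \<Rightarrow> complex \<Rightarrow> (complex set \<Rightarrow> nat) \<Rightarrow> bool" where
  "monodromy_base V E R\<^sub>1 v\<^sub>1 c \<longleftrightarrow>
     R\<^sub>1 \<in> regions V E \<and> odd_region E R\<^sub>1 \<and> v\<^sub>1 \<in> V \<inter> frontier R\<^sub>1 \<and>
     triangle_coloring V E v\<^sub>1 c \<and> c R\<^sub>1 = 2"

end

theory Submission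
  imports Defs
begin

text \<open>
  Identify a state with the set of vertices where it is 1.  A region crossing change on \<open>R\<close> adds the
  set of corners of \<open>R\<close>, in the vector space of sets of vertices over the field with two elements,
  so the classes of states are the cosets of the span of these corner sets.  If there are \<open>n\<close>
  vertices and \<open>m\<close> regions and \<open>N\<close> is the space of those sets of regions that change nothing (here
  called neutral), the number of classes is \<open>2 ^ (n - m)\<close> times the number of elements of \<open>N\<close>.  It
  remains to show that \<open>N\<close> has 4, 2 or 1 elements in the three cases (\<open>num_states_eq\<close>).

  Around each vertex there are three regions, and any two of them share exactly one edge there
  (\<open>around_structure\<close>, \<open>common_edge\<close>).  A neutral set has an even number of members among the three.
  If it has none around one vertex, then it has none around the neighbours, and by connectedness it
  is empty.  So a nonempty neutral set omits exactly one region around each vertex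
  (\<open>neutral_two_around\<close>), and there are at most four neutral sets.  Around the border of a
  member, other members and omitted regions alternate, whence members are even
  (\<open>neutral_members_even\<close>).

  If all regions are even, then the corner sets are orthogonal to themselves and to each other: two
  different regions have an even number of common corners, because these are paired by the common
  edges.  The span of the corner sets is therefore isotropic and has dimension at most
  \<open>n / 2\<close> (\<open>card_isotropic\<close>).  Euler's inequality, together with \<open>2 * card E = 3 * n\<close>, gives
  \<open>m \<ge> n / 2 + 2\<close>, so \<open>N\<close> has dimension at least 2.

  If there is an odd region \<open>R\<close>, it is omitted by every neutral set, so there is at most one nonempty
  neutral set, and there is none if two odd regions are adjacent.  A nonempty neutral set selects one
  region around each vertex, the omitted one, and this selection moves along walks in the same way
  as color 2 does.  Hence it exists exactly if color 2 always returns to \<open>R\<close>, which is the condition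
  on the monodromy (\<open>neutral_if_monodromy_fixes_color\<close>, \<open>odd_region_card_neutral\<close>).

  The topology behind this rests on the Jordan curve theorem and Janiszewski's theorem.  As
  no edge is a bridge, every edge lies on a Jordan curve in the drawing; its two sides yield the two
  regions beside the edge, and the insides of such curves yield enough sets of regions to prove
  Euler's inequality.  Since an arc does not separate the plane, no region has exactly one edge at
  one of its corners, and counting sides of edges shows that there are three regions around each
  vertex.  Finally, the frontier of a region is connected because the drawing is.
\<close>

section \<open>Walks\<close>

lemma walk_ends: "walk V E v es w \<Longrightarrow> v \<in> V \<and> w \<in> V"
  by (induction es arbitrary: v) auto

lemma walk_append: "walk V E u (es @ fs) w \<longleftrightarrow> (\<exists>v. walk V E u es v \<and> walk V E v fs w)"
proof (induction es arbitrary: u)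
  case Nil
  then show ?case using walk_ends by auto
next
  case (Cons a es)
  then show ?case by auto
qed

lemma walk_edges: "walk V E v es w \<Longrightarrow> set es \<subseteq> E"
  by (induction es arbitrary: v) auto

lemma walk_restrict: "walk V E v es w \<Longrightarrow> set es \<subseteq> D \<Longrightarrow> walk V D v es w"
  by (induction es arbitrary: v) auto

lemma walk_mono: "walk V D v es w \<Longrightarrow> D \<subseteq> E \<Longrightarrow> walk V E v es w"
  by (induction es arbitrary: v) auto

lemma walk_rev: "walk V E v es w \<Longrightarrow> walk V E w (rev es) v"
proof (induction es arbitrary: v)
  case (Cons e es)
  then obtain x where x: "e \<in> E" "e \<inter> V = {v, x}" "walk V E x es w" by auto
  then have "walk V E x [e] v" by (auto simp: insert_commute)
  with Cons.IH[OF x(3)] show ?case by (auto simp: walk_append)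
qed auto

text \<open>This is applied to shortest walks, which for this reason never return to their starting
  vertex.\<close>

lemma walk_suffix:
  assumes "walk V E v es w" "f \<in> set es" "u \<in> f \<inter> V"
  shows "\<exists>fs. walk V E u fs w \<and> length fs \<le> length es \<and> set fs \<subseteq> set es"
  using assms
proof (induction es arbitrary: v)
  case (Cons e es)
  then obtain x where x: "e \<in> E" "e \<inter> V = {v, x}" "walk V E x es w" by auto
  show ?case
  proof (cases "f = e")
    case True
    then have "u = v \<or> u = x" using Cons.prems x by auto
    then show ?thesis
    proof
      assume "u = v"
      then show ?thesis using Cons.prems(1) by (intro exI[of _ "e # es"]) auto
    next
      assume "u = x"
      then show ?thesis using x(3) by (intro exI[of _ es]) auto
    qed
  next
    case False
    then have "f \<in> set es" using Cons.prems by auto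
    from Cons.IH[OF x(3) this Cons.prems(3)] obtain fs
      where "walk V E u fs w" "length fs \<le> length es" "set fs \<subseteq> set es" by blast
    then show ?thesis by (intro exI[of _ fs]) auto
  qed
qed auto

lemma plane_graph_edge:
  assumes "plane_graph V E" "e \<in> E"
  obtains g where "simple_path g" "path_image g = e" "e \<inter> V = {pathstart g, pathfinish g}"
  using assms unfolding plane_graph_def by metis

lemma plane_graph_subset: "plane_graph V E \<Longrightarrow> D \<subseteq> E \<Longrightarrow> plane_graph V D"
  unfolding plane_graph_def by (meson finite_subset subset_eq)

lemma path_connected_walk:
  assumes "plane_graph V E" "walk V E v es w"
  shows "path_connected (insert v (\<Union>(set es))) \<and> w \<in> insert v (\<Union>(set es))"
  using assms(2)
proof (induction es arbitrary: v)
  case (Cons e es)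
  then obtain x where x: "e \<in> E" "e \<inter> V = {v, x}" "walk V E x es w" by auto
  obtain g where g: "simple_path g" "path_image g = e"
    using plane_graph_edge[OF assms(1) x(1)] by metis
  have "path_connected e" using g path_connected_path_image simple_path_imp_path by blast
  moreover have "x \<in> e" "v \<in> e" using x(2) by auto
  moreover have "path_connected (insert x (\<Union>(set es)))" "w \<in> insert x (\<Union>(set es))"
    using Cons.IH[OF x(3)] by auto
  moreover have "insert v (\<Union>(set (e # es))) = e \<union> insert x (\<Union>(set es))"
    using \<open>x \<in> e\<close> \<open>v \<in> e\<close> by auto
  moreover have "path_connected (e \<union> insert x (\<Union>(set es)))"
    using calculation by (intro path_connected_Un) auto
  ultimately show ?case by auto
qed auto

section \<open>Edges and the two regions beside them\<close>

lemma ball_meets: "p \<in> closure S \<Longrightarrow> 0 < r \<Longrightarrow> ball p r \<inter> S \<noteq> {}"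
  by (metis centre_in_ball disjoint_iff open_Int_closure_eq_empty open_ball)

locale cubic_plane_graph =
  fixes V :: "complex set" and E :: "complex set set"
  assumes plane: "plane_graph V E"
    and conn: "graph_connected V E"
    and nobridge: "bridgeless V E"
    and cubic: "trivalent V E"
begin

definition drawing :: "complex set" where
  "drawing = V \<union> \<Union>E"

text \<open>The ends of \<open>e\<close> are kept, so that the set is compact and meets \<open>e\<close> in its ends.\<close>

definition drawing_without :: "complex set \<Rightarrow> complex set" where
  "drawing_without e = V \<union> \<Union>(E - {e})"

definition beside :: "complex set \<Rightarrow> complex set set" where
  "beside e = {R \<in> regions V E. e \<subseteq> frontier R}"

lemma finite_V: "finite V" and finite_E: "finite E"
  using plane unfolding plane_graph_def by auto

lemma edges_meet: "e \<in> E \<Longrightarrow> f \<in> E \<Longrightarrow> e \<noteq> f \<Longrightarrow> e \<inter> f \<subseteq> V"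
  using plane unfolding plane_graph_def by blast

lemma compact_edge: "e \<in> E \<Longrightarrow> compact e"
  using plane_graph_edge[OF plane] compact_simple_path_image by metis

lemma compact_Union_edges: "D \<subseteq> E \<Longrightarrow> compact (\<Union>D)"
  using finite_subset[OF _ finite_E] compact_edge by (intro compact_Union) auto

lemma compact_drawing: "compact drawing"
  unfolding drawing_def using compact_Union_edges[of E] finite_V
  by (simp add: compact_Un finite_imp_compact)

lemma compact_drawing_without: "compact (drawing_without e)"
  unfolding drawing_without_def using compact_Union_edges[of "E - {e}"] finite_V
  by (simp add: compact_Un finite_imp_compact)

lemma drawing_split: "e \<in> E \<Longrightarrow> drawing = e \<union> drawing_without e"
  unfolding drawing_def drawing_without_def by blast

lemma edge_Int_drawing_without: "e \<in> E \<Longrightarrow> e \<inter> drawing_without e = e \<inter> V"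
  unfolding drawing_without_def using edges_meet by blast

lemma walk_exists: "v \<in> V \<Longrightarrow> w \<in> V \<Longrightarrow> \<exists>es. walk V E v es w"
  using conn unfolding graph_connected_def by blast

lemma V_nonempty: "V \<noteq> {}"
  using conn unfolding graph_connected_def by blast

text \<open>A loop at \<open>v\<close> uses up two of the three edge ends at \<open>v\<close>, so the only other edge at \<open>v\<close>
  separates \<open>v\<close> from the rest of the graph.\<close>

lemma no_loop:
  assumes "e \<in> E"
  shows "e \<inter> V \<noteq> {v}"
proof
  assume loop: "e \<inter> V = {v}"
  let ?A = "{f \<in> E. v \<in> f}" and ?B = "{f \<in> E. f \<inter> V = {v}}"
  have "v \<in> V" using loop by auto
  then have deg: "card ?A + card ?B = 3"
    using cubic unfolding trivalent_def degree_def by auto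
  have fin: "finite ?A" "finite ?B" using finite_E by auto
  have sub: "?B \<subseteq> ?A" by auto
  have "card ?B \<le> card ?A" using card_mono[OF fin(1) sub] .
  moreover have "card ?B \<noteq> 0" using loop assms fin by auto
  ultimately have cards: "card ?A = 2" "card ?B = 1" using deg by linarith+
  have "\<not> ?A \<subseteq> ?B"
  proof
    assume "?A \<subseteq> ?B"
    from card_mono[OF fin(2) this] show False using cards by simp
  qed
  then obtain f where f: "f \<in> E" "v \<in> f" "f \<inter> V \<noteq> {v}" by auto
  obtain g where "f \<inter> V = {pathstart g, pathfinish g}"
    using plane_graph_edge[OF plane f(1)] by metis
  then obtain x where x: "f \<inter> V = {v, x}" "x \<noteq> v"
    using f \<open>v \<in> V\<close> by (metis IntI insertE insert_commute singletonD insert_absorb2)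
  have "e \<noteq> f" using loop x by auto
  have A: "?A = {e, f}"
  proof (rule sym, rule card_subset_eq[OF fin(1)])
    show "{e, f} \<subseteq> ?A" using assms loop f by auto
    show "card {e, f} = card ?A" using cards \<open>e \<noteq> f\<close> by auto
  qed
  have stay: "walk V (E - {f}) v es w \<Longrightarrow> w = v" for es w
  proof (induction es)
    case (Cons a es)
    then obtain y where y: "a \<in> E - {f}" "a \<inter> V = {v, y}" "walk V (E - {f}) y es w" by auto
    then have "a \<in> ?A" by auto
    then have "a = e" using A y by auto
    then have "y = v" using y loop by (metis doubleton_eq_iff insert_absorb2)
    then show ?case using Cons y by auto
  qed auto
  have "bridge V E f" unfolding bridge_def using f x stay by blast
  then show False using nobridge f unfolding bridgeless_def by auto
qed

lemma edge_ends:
  assumes "e \<in> E"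
  obtains v x where "e \<inter> V = {v, x}" "v \<noteq> x"
  using plane_graph_edge[OF plane assms] no_loop[OF assms] by (metis insert_absorb2)

lemma card_edge_ends: "e \<in> E \<Longrightarrow> card (e \<inter> V) = 2"
  by (rule edge_ends) auto

lemma other_end:
  assumes "e \<in> E" "v \<in> e \<inter> V"
  obtains x where "e \<inter> V = {v, x}" "v \<noteq> x"
proof -
  obtain a b where ab: "e \<inter> V = {a, b}" "a \<noteq> b" using edge_ends[OF assms(1)] .
  then have "v = a \<or> v = b" using assms(2) by auto
  then show ?thesis using that[of b] that[of a] ab by (auto simp: insert_commute)
qed

lemma card_edges_at: "v \<in> V \<Longrightarrow> card {e \<in> E. v \<in> e} = 3"
proof -
  assume "v \<in> V"
  then have "card {e \<in> E. v \<in> e} + card {e \<in> E. e \<inter> V = {v}} = 3"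
    using cubic unfolding trivalent_def degree_def by auto
  moreover have "{e \<in> E. e \<inter> V = {v}} = {}" using no_loop by blast
  ultimately show ?thesis by auto
qed

lemma edge_arc:
  assumes "e \<in> E" "e \<inter> V = {v, x}" "v \<noteq> x"
  obtains g where "arc g" "path_image g = e" "pathstart g = v" "pathfinish g = x"
proof -
  obtain g where g: "simple_path g" "path_image g = e" "e \<inter> V = {pathstart g, pathfinish g}"
    using plane_graph_edge[OF plane assms(1)] by metis
  then have ends: "{pathstart g, pathfinish g} = {v, x}" using assms by auto
  then have "pathstart g \<noteq> pathfinish g" using assms(3) by auto
  then have "arc g" using g(1) by (simp add: arc_simple_path)
  show ?thesis
  proof (cases "pathstart g = v")
    case True
    then have "pathfinish g = x" using ends by (metis doubleton_eq_iff)
    then show ?thesis using that[OF \<open>arc g\<close> g(2) True] by blast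
  next
    case False
    then have "pathfinish g = v" "pathstart g = x" using ends by (metis doubleton_eq_iff)+
    then show ?thesis using that[of "reversepath g"] \<open>arc g\<close> g(2) by (simp add: arc_reversepath)
  qed
qed

lemma edge_interior:
  assumes "e \<in> E"
  shows "connected (e - V)" "e - V \<noteq> {}" "e \<subseteq> closure (e - V)"
proof -
  obtain v x where vx: "e \<inter> V = {v, x}" "v \<noteq> x" using edge_ends[OF assms] .
  obtain g where g: "arc g" "path_image g = e" "pathstart g = v" "pathfinish g = x"
    using edge_arc[OF assms vx] .
  have sp: "simple_path g" using g arc_imp_simple_path by blast
  have eq: "e - V = path_image g - {pathstart g, pathfinish g}" using g vx by auto
  show "connected (e - V)" unfolding eq using connected_simple_path_endless[OF sp] .
  show ne: "e - V \<noteq> {}" unfolding eq using nonempty_simple_path_endless[OF sp] .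
  have eq2: "e - V = g ` {0<..<1}" unfolding eq using simple_path_endless[OF sp] .
  have "g ` closure {0<..<1} \<subseteq> closure (g ` {0<..<1})"
  proof (rule image_closure_subset)
    show "continuous_on (closure {0<..<1}) g"
      using arc_imp_path[OF g(1)] by (simp add: path_def)
    show "g ` {0<..<1} \<subseteq> closure (g ` {0<..<1})" by (rule closure_subset)
  qed simp
  then show "e \<subseteq> closure (e - V)"
    unfolding eq2 using g(2) by (simp add: path_image_def)
qed

lemma connected_drawing: "connected drawing"
proof -
  obtain v0 where v0: "v0 \<in> V" using V_nonempty by auto
  define C where "C = {insert v0 (\<Union>(set es)) | es w. walk V E v0 es w}"
  have "connected (\<Union>C)"
  proof (rule connected_Union)
    show "connected S" if "S \<in> C" for S
      using that path_connected_walk[OF plane] path_connected_imp_connected unfolding C_def by blast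
    show "\<Inter>C \<noteq> {}" unfolding C_def by auto
  qed
  moreover have "\<Union>C = drawing"
  proof
    show "\<Union>C \<subseteq> drawing" unfolding C_def drawing_def using v0 walk_edges by fastforce
    show "drawing \<subseteq> \<Union>C"
    proof
      fix p assume "p \<in> drawing"
      then consider "p \<in> V" | e where "e \<in> E" "p \<in> e" unfolding drawing_def by auto
      then show "p \<in> \<Union>C"
      proof cases
        case 1
        then obtain es where "walk V E v0 es p" using walk_exists v0 by blast
        then have "p \<in> insert v0 (\<Union>(set es))" "insert v0 (\<Union>(set es)) \<in> C"
          using path_connected_walk[OF plane] unfolding C_def by auto
        then show ?thesis by blast
      next
        case 2
        obtain v x where vx: "e \<inter> V = {v, x}" using edge_ends[OF 2(1)] by metis
        then obtain es where "walk V E v0 es v" using walk_exists v0 by blast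
        then have "walk V E v0 (es @ [e]) x" using 2 vx
          by (auto simp: walk_append intro!: exI[of _ v])
        then have "insert v0 (\<Union>(set (es @ [e]))) \<in> C" unfolding C_def by blast
        then show ?thesis using 2 by (intro UnionI[of "insert v0 (\<Union>(set (es @ [e])))"]) auto
      qed
    qed
  qed
  ultimately show ?thesis by simp
qed

lemma regions_eq: "regions V E = components (- drawing)"
  unfolding regions_def drawing_def ..

lemma region_facts:
  assumes "R \<in> regions V E"
  shows "open R" "connected R" "R \<noteq> {}" "R \<inter> drawing = {}" "frontier R \<subseteq> drawing" "connected (frontier R)"
proof -
  have R: "R \<in> components (- drawing)" using assms regions_eq by simp
  have cl: "closed drawing" using compact_drawing compact_imp_closed by blast
  show "open R" using open_components[OF _ R] cl by (simp add: open_Compl)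
  show "connected R" using in_components_connected[OF R] .
  show "R \<noteq> {}" using in_components_nonempty[OF R] .
  show "R \<inter> drawing = {}" using in_components_subset[OF R] by blast
  show "frontier R \<subseteq> drawing" using frontier_of_components_closed_complement[OF cl R] .
  show "connected (frontier R)" using connected_frontier_component_complement[OF connected_drawing R] .
qed

lemma regions_eqI: "R \<in> regions V E \<Longrightarrow> Q \<in> regions V E \<Longrightarrow> p \<in> R \<Longrightarrow> p \<in> Q \<Longrightarrow> R = Q"
  unfolding regions_eq using components_eq by blast

lemma region_at: "p \<notin> drawing \<Longrightarrow> \<exists>R\<in>regions V E. p \<in> R"
  unfolding regions_eq using Union_components by blast

text \<open>The edges of a walk form a path connected set, and path connected sets are arcwise connected.
  An arc obtained in this way closes up with \<open>e\<close>, since edges meet in vertices only.\<close>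

lemma Jordan_curve_through_edge:
  assumes "e \<in> E" "e \<inter> V = {v, x}" "v \<noteq> x" "walk V D v es x" "D \<subseteq> E - {e}"
  obtains c A where "simple_path c" "pathfinish c = pathstart c" "path_image c = e \<union> A"
    "connected A" "A \<subseteq> V \<union> \<Union>D" "e \<inter> V \<subseteq> A"
proof -
  have pD: "plane_graph V D" using plane_graph_subset[OF plane] assms(5) by blast
  have vV: "v \<in> V" using assms(2) by blast
  have "path_connected (insert v (\<Union>(set es)))" "x \<in> insert v (\<Union>(set es))"
    using path_connected_walk[OF pD assms(4)] by auto
  then obtain g where g: "arc g" "path_image g \<subseteq> insert v (\<Union>(set es))" "pathstart g = v" "pathfinish g = x"
    using assms(3) unfolding path_connected_arcwise by blast
  have gA: "path_image g \<subseteq> V \<union> \<Union>D" using g(2) vV walk_edges[OF assms(4)] by blast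
  obtain h where h: "arc h" "path_image h = e" "pathstart h = v" "pathfinish h = x"
    using edge_arc[OF assms(1-3)] .
  have "path_image h \<inter> path_image (reversepath g) \<subseteq> {v, x}"
  proof -
    have "e \<inter> (V \<union> \<Union>D) \<subseteq> e \<inter> V"
      using assms(5) edges_meet[OF assms(1)] by blast
    then show ?thesis using h gA assms(2) by auto
  qed
  then have "simple_path (h +++ reversepath g)"
    using g h by (subst simple_path_join_loop_eq) (auto simp: arc_reversepath)
  then show ?thesis
    using g h gA assms(2)
    by (intro that[of "h +++ reversepath g" "path_image g"])
      (auto simp: path_image_join connected_arc_image)
qed

text \<open>Near an interior point \<open>p\<close> of \<open>e\<close>, the part of the complement on one side \<open>S\<close> of a Jordan curve
  through \<open>e\<close> lies in a single region: two points near \<open>p\<close> are joined off the curve inside \<open>S\<close>, and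
  joined off the rest of the drawing inside a small disc, so Janiszewski's theorem joins them off
  the whole drawing.\<close>

lemma one_region_per_side:
  assumes e: "e \<in> E" and C: "compact C" "C = e \<union> A" "connected A" "A \<subseteq> drawing_without e" "e \<inter> V \<subseteq> A"
    and S: "connected S" "frontier S = C" "S \<inter> C = {}"
    and p: "p \<in> e - V" and r: "r > 0" "ball p r \<inter> drawing_without e = {}"
  obtains Q where "Q \<in> regions V E" "Q \<subseteq> S" "S \<inter> ball p r \<subseteq> Q"
    "\<And>q. q \<in> e \<inter> ball p r \<Longrightarrow> q \<in> frontier Q"
proof -
  have CK: "C \<union> drawing_without e = drawing"
    using C(2,4) drawing_split[OF e] by auto
  have off: "b \<notin> drawing" if "b \<in> S \<inter> ball p r" for b
    using that S(3) r(2) CK by blast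
  have near: "q \<in> closure (S \<inter> ball p r)" if "q \<in> e \<inter> ball p r" for q
  proof -
    have "q \<in> closure S" using that S(2) C(2) by (auto simp: frontier_def)
    then show ?thesis using that open_Int_closure_subset[of "ball p r" S]
      by (auto simp: Int_commute)
  qed
  have "p \<in> closure (S \<inter> ball p r)" using near p r by auto
  then obtain a where a: "a \<in> S \<inter> ball p r" by (metis closure_empty emptyE equals0I)
  obtain Q where Q: "Q \<in> regions V E" "a \<in> Q" using region_at off[OF a] by blast
  have sub: "S \<inter> ball p r \<subseteq> Q"
  proof
    fix b assume b: "b \<in> S \<inter> ball p r"
    have "connected_component (- (C \<union> drawing_without e)) a b"
    proof (rule Janiszewski)
      show "closed (drawing_without e)" using compact_drawing_without compact_imp_closed by blast
      have "C \<inter> drawing_without e = A"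
        using C edge_Int_drawing_without[OF e] by blast
      then show "connected (C \<inter> drawing_without e)" using C by simp
      show "connected_component (- C) a b"
        unfolding connected_component_def using S a b by (intro exI[of _ S]) auto
      show "connected_component (- drawing_without e) a b"
        unfolding connected_component_def using r a b by (intro exI[of _ "ball p r"]) auto
    qed (rule C(1))
    then have "connected_component (- drawing) a b" unfolding CK .
    then obtain U where U: "connected U" "U \<subseteq> - drawing" "a \<in> U" "b \<in> U"
      unfolding connected_component_def by blast
    then have "U \<subseteq> Q"
      using components_maximal Q unfolding regions_eq by blast
    then show "b \<in> Q" using U by auto
  qed
  have "Q \<subseteq> S"
  proof (rule ccontr)
    assume "\<not> Q \<subseteq> S"
    then have "Q \<inter> frontier S \<noteq> {}"
      using connected_Int_frontier[of Q S] Q region_facts(2) a by blast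
    then show False using S(2) region_facts(4)[OF Q(1)] CK by blast
  qed
  moreover have "q \<in> frontier Q" if "q \<in> e \<inter> ball p r" for q
  proof -
    have "q \<in> closure Q" using near[OF that] closure_mono[OF sub] by blast
    moreover have "q \<notin> Q" using region_facts(4)[OF Q(1)] that drawing_split[OF e] by blast
    moreover have "interior Q = Q" using region_facts(1)[OF Q(1)] interior_open by blast
    ultimately show ?thesis unfolding frontier_def by auto
  qed
  ultimately show ?thesis using that Q sub by blast
qed

text \<open>Near an interior point of \<open>e\<close> each side of the curve belongs to a single region.  The pair of
  these two regions is therefore locally constant along the interior of \<open>e\<close>, which is
  connected.\<close>

lemma two_regions_beside_edge:
  assumes e: "e \<in> E" and c: "simple_path c" "pathfinish c = pathstart c"
    and A: "path_image c = e \<union> A" "connected A" "A \<subseteq> drawing_without e" "e \<inter> V \<subseteq> A"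
  obtains Q Q' where "Q \<in> regions V E" "Q' \<in> regions V E"
    "Q \<subseteq> inside (path_image c)" "Q' \<subseteq> outside (path_image c)"
    "\<And>p. p \<in> e - V \<Longrightarrow> {R \<in> regions V E. p \<in> frontier R} = {Q, Q'}"
proof -
  let ?C = "path_image c" and ?F = "\<lambda>p. {R \<in> regions V E. p \<in> frontier R}"
  note J = Jordan_inside_outside[OF c]
  have local: "\<exists>r>0. \<exists>Q\<in>regions V E. \<exists>Q'\<in>regions V E. Q \<subseteq> inside ?C \<and> Q' \<subseteq> outside ?C \<and>
      (\<forall>q\<in>(e - V) \<inter> ball p r. ?F q = {Q, Q'})" if p: "p \<in> e - V" for p
  proof -
    have "p \<notin> drawing_without e" using p edge_Int_drawing_without[OF e] by blast
    then obtain r where r: "r > 0" "ball p r \<inter> drawing_without e = {}"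
      using compact_drawing_without[of e] compact_imp_closed
      by (metis Compl_iff disjoint_eq_subset_Compl openE open_Compl)
    have cC: "compact ?C" using c compact_simple_path_image by blast
    have dis: "inside ?C \<inter> ?C = {}" "outside ?C \<inter> ?C = {}" using J by blast+
    obtain Q where Q: "Q \<in> regions V E" "Q \<subseteq> inside ?C" "inside ?C \<inter> ball p r \<subseteq> Q"
        "\<And>q. q \<in> e \<inter> ball p r \<Longrightarrow> q \<in> frontier Q"
      using one_region_per_side[OF e cC A _ _ dis(1) p r] J by metis
    obtain Q' where Q': "Q' \<in> regions V E" "Q' \<subseteq> outside ?C" "outside ?C \<inter> ball p r \<subseteq> Q'"
        "\<And>q. q \<in> e \<inter> ball p r \<Longrightarrow> q \<in> frontier Q'"
      using one_region_per_side[OF e cC A _ _ dis(2) p r] J by metis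
    have "?F q = {Q, Q'}" if q: "q \<in> (e - V) \<inter> ball p r" for q
    proof (rule equalityI)
      show "{Q, Q'} \<subseteq> ?F q" using Q Q' q by auto
      show "?F q \<subseteq> {Q, Q'}"
      proof
        fix R assume R: "R \<in> ?F q"
        then have "q \<in> closure R" by (auto simp: frontier_def)
        then have "ball p r \<inter> R \<noteq> {}"
          using q open_Int_closure_eq_empty[of "ball p r" R] by auto
        then obtain b where b: "b \<in> ball p r" "b \<in> R" by blast
        have "b \<notin> drawing" using R b region_facts(4) by blast
        then have "b \<notin> ?C" using A(1,3) drawing_split[OF e] by auto
        then have "b \<in> inside ?C \<or> b \<in> outside ?C" using J by blast
        then have "b \<in> Q \<or> b \<in> Q'" using b Q Q' by blast
        then show "R \<in> {Q, Q'}" using regions_eqI R b Q Q' by auto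
      qed
    qed
    then show ?thesis using r Q Q' by blast
  qed
  have "?F constant_on (e - V)"
  proof (rule locally_constant_imp_constant[OF edge_interior(1)[OF e]])
    fix p assume p: "p \<in> e - V"
    obtain r Q Q' where r: "r > 0" "\<forall>q\<in>(e - V) \<inter> ball p r. ?F q = {Q, Q'}"
      using local[OF p] by metis
    then have "?F p = {Q, Q'}" using p by auto
    with r p show "\<exists>T. openin (top_of_set (e - V)) T \<and> p \<in> T \<and> (\<forall>x\<in>T. ?F x = ?F p)"
      by (intro exI[of _ "(e - V) \<inter> ball p r"]) (simp add: openin_open_Int)
  qed
  then obtain y where y: "\<And>p. p \<in> e - V \<Longrightarrow> ?F p = y" unfolding constant_on_def by blast
  obtain p where p: "p \<in> e - V" using edge_interior(2)[OF e] by blast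
  obtain r Q Q' where r: "r > 0" "Q\<in>regions V E" "Q'\<in>regions V E"
    "Q \<subseteq> inside ?C" "Q' \<subseteq> outside ?C" "\<forall>q\<in>(e - V) \<inter> ball p r. ?F q = {Q, Q'}"
    using local[OF p] by blast
  then have "?F p = {Q, Q'}" using p by auto
  then have "y = {Q, Q'}" using y[OF p] by simp
  then show ?thesis using that[OF r(2-5)] y by blast
qed

text \<open>Frontiers are closed and \<open>e\<close> is the closure of its interior, so a region that touches the interior
  of \<open>e\<close> everywhere has the whole edge on its frontier.\<close>

lemma beside_eq_touching:
  assumes e: "e \<in> E" and c: "simple_path c" "pathfinish c = pathstart c"
    and A: "path_image c = e \<union> A" "connected A" "A \<subseteq> drawing_without e" "e \<inter> V \<subseteq> A"
  obtains Q Q' where "Q \<in> regions V E" "Q' \<in> regions V E" "Q \<noteq> Q'" "beside e = {Q, Q'}"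
    "Q \<subseteq> inside (path_image c)" "Q' \<subseteq> outside (path_image c)"
    "\<And>p. p \<in> e - V \<Longrightarrow> {R \<in> regions V E. p \<in> frontier R} = beside e"
proof (rule two_regions_beside_edge[OF assms])
  fix Q Q'
  assume Q: "Q \<in> regions V E" "Q' \<in> regions V E"
    "Q \<subseteq> inside (path_image c)" "Q' \<subseteq> outside (path_image c)"
    "\<And>p. p \<in> e - V \<Longrightarrow> {R \<in> regions V E. p \<in> frontier R} = {Q, Q'}"
  have "beside e = {Q, Q'}"
  proof (rule equalityI)
    obtain p where p: "p \<in> e - V" using edge_interior(2)[OF e] by blast
    show "beside e \<subseteq> {Q, Q'}" using Q(5)[OF p] p unfolding beside_def by blast
    have "e \<subseteq> frontier R" if "R = Q \<or> R = Q'" for R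
    proof -
      have "e - V \<subseteq> frontier R" using Q(5) that by blast
      then have "closure (e - V) \<subseteq> frontier R" by (simp add: closure_minimal)
      then show ?thesis using edge_interior(3)[OF e] by blast
    qed
    then show "{Q, Q'} \<subseteq> beside e" using Q(1,2) unfolding beside_def by auto
  qed
  moreover have "Q \<noteq> Q'"
    using Q(3,4) Jordan_inside_outside[OF c] region_facts(3)[OF Q(1)] by blast
  ultimately show ?thesis using that[of Q Q'] Q by auto
qed

lemma detour:
  assumes "e \<in> E" "e \<inter> V = {v, x}"
  shows "\<exists>es. walk V (E - {e}) v es x"
  using nobridge assms unfolding bridgeless_def bridge_def by blast

lemma curve_through_edge:
  assumes "e \<in> E" "e \<inter> V = {v, x}" "v \<noteq> x" "walk V D v es x" "D \<subseteq> E - {e}"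
  obtains c A where "simple_path c" "pathfinish c = pathstart c" "path_image c = e \<union> A"
    "connected A" "A \<subseteq> drawing_without e" "e \<inter> V \<subseteq> A" "A \<subseteq> V \<union> \<Union>D"
proof (rule Jordan_curve_through_edge[OF assms])
  fix c A
  assume c: "simple_path c" "pathfinish c = pathstart c" "path_image c = e \<union> A"
    "connected A" "A \<subseteq> V \<union> \<Union>D" "e \<inter> V \<subseteq> A"
  have "A \<subseteq> drawing_without e" using c(5) assms(5) unfolding drawing_without_def by blast
  from that[OF c(1-4) this c(6,5)] show ?thesis .
qed

lemma beside_edge:
  assumes e: "e \<in> E"
  shows "card (beside e) = 2" "\<And>p. p \<in> e - V \<Longrightarrow> {R \<in> regions V E. p \<in> frontier R} = beside e"
proof -
  obtain v x where vx: "e \<inter> V = {v, x}" "v \<noteq> x" using edge_ends[OF e] .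
  obtain es where "walk V (E - {e}) v es x" using detour[OF e vx(1)] by blast
  from curve_through_edge[OF e vx this order_refl] obtain c A where
    "simple_path c" "pathfinish c = pathstart c" "path_image c = e \<union> A"
    "connected A" "A \<subseteq> drawing_without e" "e \<inter> V \<subseteq> A" by metis
  from beside_eq_touching[OF e this] obtain Q Q' where
    "Q \<noteq> Q'" "beside e = {Q, Q'}"
    "\<And>p. p \<in> e - V \<Longrightarrow> {R \<in> regions V E. p \<in> frontier R} = beside e" by metis
  then show "card (beside e) = 2" "\<And>p. p \<in> e - V \<Longrightarrow> {R \<in> regions V E. p \<in> frontier R} = beside e"
    by simp_all
qed

lemmas card_beside = beside_edge(1)

lemma beside_if_touching:
  assumes "e \<in> E" "p \<in> e - V" "R \<in> regions V E" "p \<in> frontier R"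
  shows "e \<subseteq> frontier R"
  using beside_edge(2)[OF assms(1,2)] assms(3,4) unfolding beside_def by blast

text \<open>\<open>X\<close> consists of the regions inside a Jordan curve that is made of \<open>e\<close> and an arc along \<open>D\<close>.  The
  two regions beside \<open>e\<close> lie on different sides of it.  Any other edge off \<open>D\<close> misses the curve
  except in vertices, so its interior joins the two regions beside it within one side.\<close>

lemma cycle_separates_regions:
  assumes e: "e \<in> E" "e \<inter> V = {v, x}" "walk V D v es x" "D \<subseteq> E - {e}"
  obtains X where "X \<subseteq> regions V E" "card (beside e \<inter> X) = 1"
    "\<And>f. f \<in> E \<Longrightarrow> f \<notin> insert e D \<Longrightarrow> beside f \<subseteq> X \<or> beside f \<inter> X = {}"
proof -
  have "v \<noteq> x" using no_loop[OF e(1)] e(2) by (metis insert_absorb2)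
  from curve_through_edge[OF e(1,2) this e(3,4)] obtain c A where c:
    "simple_path c" "pathfinish c = pathstart c" "path_image c = e \<union> A"
    "connected A" "A \<subseteq> drawing_without e" "e \<inter> V \<subseteq> A" "A \<subseteq> V \<union> \<Union>D" .
  let ?C = "path_image c"
  obtain Q Q' where Q: "Q \<in> regions V E" "Q' \<in> regions V E" "Q \<noteq> Q'" "beside e = {Q, Q'}"
    "Q \<subseteq> inside ?C" "Q' \<subseteq> outside ?C"
    using beside_eq_touching[OF e(1) c(1-6)] by metis
  note J = Jordan_inside_outside[OF c(1,2)]
  define X where "X = {R \<in> regions V E. R \<subseteq> inside ?C}"
  have "Q' \<notin> X" using Q(6) J region_facts(3)[OF Q(2)] unfolding X_def by blast
  then have "beside e \<inter> X = {Q}" using Q unfolding X_def by auto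
  moreover have "beside f \<subseteq> X \<or> beside f \<inter> X = {}" if f: "f \<in> E" "f \<notin> insert e D" for f
  proof (rule disjCI)
    assume "beside f \<inter> X \<noteq> {}"
    then obtain R where R: "R \<in> beside f" "R \<subseteq> inside ?C" unfolding X_def by blast
    show "beside f \<subseteq> X"
    proof
      fix R' assume R': "R' \<in> beside f"
      have fC: "(f - V) \<inter> ?C = {}"
        using c(3,7) f edges_meet[OF f(1)] e(1,4) by blast
      have con: "connected ((f - V) \<union> S)" if "S \<in> beside f" for S
      proof (rule connected_intermediate_closure)
        show "connected S" using that region_facts(2) unfolding beside_def by blast
        show "(f - V) \<union> S \<subseteq> closure S"
          using that closure_subset[of S] unfolding beside_def frontier_def by blast
      qed auto
      have "connected (((f - V) \<union> R) \<union> ((f - V) \<union> R'))"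
        by (rule connected_Un[OF con[OF R(1)] con[OF R']]) (use edge_interior(2)[OF f(1)] in blast)
      moreover have "R \<inter> ?C = {}" "R' \<inter> ?C = {}"
        using R R' region_facts(4) c(3,5) drawing_split[OF e(1)] unfolding beside_def by blast+
      moreover have "R \<noteq> {}" using R region_facts(3) unfolding beside_def by blast
      moreover have "frontier (inside ?C) = ?C" using J by blast
      ultimately have "((f - V) \<union> R) \<union> ((f - V) \<union> R') \<subseteq> inside ?C"
        using connected_Int_frontier[of "((f - V) \<union> R) \<union> ((f - V) \<union> R')" "inside ?C"]
          R(2) fC by blast
      then show "R' \<in> X" using R' unfolding X_def beside_def by auto
    qed
  qed
  ultimately show ?thesis using that[of X] unfolding X_def by auto
qed

section \<open>The three regions around a vertex\<close>

definition edges_at :: "complex \<Rightarrow> complex set set" where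
  "edges_at v = {e \<in> E. v \<in> e}"

definition around :: "complex \<Rightarrow> complex set set" where
  "around v = {R \<in> regions V E. v \<in> frontier R}"

lemma finite_edges_at: "finite (edges_at v)"
  unfolding edges_at_def using finite_E by auto

lemma card_edges_at_eq: "v \<in> V \<Longrightarrow> card (edges_at v) = 3"
  unfolding edges_at_def using card_edges_at .

text \<open>If no edge of \<open>R\<close> ended at \<open>v\<close>, then \<open>v\<close> would be an isolated point of the frontier of \<open>R\<close>,
  and \<open>R\<close> would fill a punctured disc around \<open>v\<close>, although the edges at \<open>v\<close> enter that disc.\<close>

lemma region_has_edge_at:
  assumes v: "v \<in> V" and R: "R \<in> around v"
  shows "\<exists>e\<in>edges_at v. R \<in> beside e"
proof (rule ccontr)
  assume none: "\<not> ?thesis"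
  have Rr: "R \<in> regions V E" "v \<in> frontier R" using R unfolding around_def by auto
  let ?L = "(V - {v}) \<union> \<Union>(E - edges_at v)"
  have "closed ?L"
    using compact_Union_edges[of "E - edges_at v"] finite_V
    by (simp add: closed_Un finite_imp_closed compact_imp_closed)
  moreover have "v \<notin> ?L" unfolding edges_at_def by auto
  ultimately obtain r where r: "r > 0" "ball v r \<subseteq> - ?L"
    by (metis openE open_Compl ComplI)
  let ?S = "ball v r - {v}"
  have vR: "v \<notin> R" using region_facts(4)[OF Rr(1)] v unfolding drawing_def by blast
  have "frontier R \<inter> ?S = {}"
  proof (rule ccontr)
    assume "frontier R \<inter> ?S \<noteq> {}"
    then obtain q where q: "q \<in> frontier R" "q \<in> ball v r" "q \<noteq> v" by blast
    then have "q \<in> drawing" "q \<notin> ?L" using r region_facts(5)[OF Rr(1)] by blast+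
    then obtain e where e: "e \<in> edges_at v" "q \<in> e - V"
      using q(3) unfolding drawing_def by blast
    then have "e \<subseteq> frontier R"
      using beside_if_touching[of e q R] q Rr unfolding edges_at_def by blast
    then show False using none e(1) Rr unfolding beside_def by blast
  qed
  moreover have "connected ?S"
    by (rule connected_punctured_convex) (use r(1) in \<open>auto simp: aff_dim_open\<close>)
  moreover have "?S \<inter> R \<noteq> {}"
  proof -
    have "v \<in> closure R" using Rr(2) by (simp add: frontier_def)
    then have "ball v r \<inter> R \<noteq> {}"
      using ball_meets r(1) by blast
    then show ?thesis using vR by blast
  qed
  moreover have "?S - R \<noteq> {}"
  proof -
    have "edges_at v \<noteq> {}" using card_edges_at_eq[OF v] by auto
    then obtain e where e: "e \<in> E" "v \<in> e" unfolding edges_at_def by blast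
    then have "v \<in> closure (e - V)" using edge_interior(3) by blast
    then have "ball v r \<inter> (e - V) \<noteq> {}"
      using ball_meets r(1) by blast
    moreover have "R \<inter> e = {}" using region_facts(4)[OF Rr(1)] e unfolding drawing_def by blast
    ultimately show ?thesis using v by blast
  qed
  ultimately show False using connected_Int_frontier[of ?S R] by blast
qed

lemma beside_pair:
  assumes "e \<in> E" "R \<in> beside e"
  obtains R' where "beside e = {R, R'}" "R \<noteq> R'"
proof -
  obtain A B where AB: "beside e = {A, B}" "A \<noteq> B"
    using card_beside[OF assms(1)] by (meson card_2_iff)
  then have "R = A \<or> R = B" using assms(2) by blast
  then show ?thesis using that[of A] that[of B] AB by (metis insert_commute)
qed

lemma frontier_eq_Union_edges:
  assumes R: "R \<in> regions V E"
  shows "frontier R = \<Union>{e \<in> E. R \<in> beside e}"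
proof
  show "\<Union>{e \<in> E. R \<in> beside e} \<subseteq> frontier R" unfolding beside_def by blast
  show "frontier R \<subseteq> \<Union>{e \<in> E. R \<in> beside e}"
  proof
    fix p assume p: "p \<in> frontier R"
    show "p \<in> \<Union>{e \<in> E. R \<in> beside e}"
    proof (cases "p \<in> V")
      case True
      then show ?thesis using region_has_edge_at[of p R] p R
        unfolding around_def edges_at_def by blast
    next
      case False
      then obtain e where "e \<in> E" "p \<in> e - V"
        using p region_facts(5)[OF R] unfolding drawing_def by blast
      then show ?thesis using beside_if_touching[of e p R] p R unfolding beside_def by blast
    qed
  qed
qed

text \<open>If \<open>e\<close> were the only edge of \<open>R\<close> at \<open>v\<close>, then \<open>e\<close> would meet the other edges of \<open>R\<close> at its
  other end at most.  An arc does not separate the plane, so by Janiszewski's theorem \<open>e\<close> could not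
  separate the two regions beside it within the frontier of \<open>R\<close>.\<close>

lemma region_has_second_edge_at:
  assumes v: "v \<in> V" and e: "e \<in> edges_at v" "R \<in> beside e"
  shows "\<exists>f\<in>edges_at v. f \<noteq> e \<and> R \<in> beside f"
proof (rule ccontr)
  assume only: "\<not> ?thesis"
  have eE: "e \<in> E" "v \<in> e" and R: "R \<in> regions V E"
    using e unfolding edges_at_def beside_def by auto
  obtain x where x: "e \<inter> V = {v, x}" "v \<noteq> x" using other_end[OF eE(1)] eE v by blast
  let ?D = "{f \<in> E. R \<in> beside f} - {e}"
  let ?L = "\<Union>?D"
  have fr: "frontier R = e \<union> ?L" using frontier_eq_Union_edges[OF R] e(2) eE by blast
  have LK: "?L \<subseteq> drawing_without e" unfolding drawing_without_def by blast
  have "v \<notin> ?L" using only unfolding edges_at_def by blast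
  moreover have "e \<inter> ?L \<subseteq> {v, x}" using edge_Int_drawing_without[OF eE(1)] LK unfolding x(1) by blast
  ultimately have "e \<inter> ?L \<subseteq> {x}" by blast
  then have con: "connected (e \<inter> ?L)" using subset_singletonD by fastforce
  obtain R' where R': "beside e = {R, R'}" "R \<noteq> R'"
    using beside_pair[OF eE(1) e(2)] .
  obtain p where p: "p \<in> e - V" using edge_interior(2)[OF eE(1)] by blast
  have "p \<notin> drawing_without e" using p edge_Int_drawing_without[OF eE(1)] by blast
  then obtain r where r: "r > 0" "ball p r \<subseteq> - drawing_without e"
    using compact_drawing_without[of e] by (metis openE open_Compl ComplI compact_imp_closed)
  have enter: "\<exists>a. a \<in> Q \<and> a \<in> ball p r" if "Q \<in> beside e" for Q
  proof -
    have "p \<in> closure Q" using that p unfolding beside_def frontier_def by blast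
    then have "ball p r \<inter> Q \<noteq> {}"
      using ball_meets r(1) by blast
    then show ?thesis by blast
  qed
  obtain a where a: "a \<in> R" "a \<in> ball p r" using enter[OF e(2)] by blast
  obtain b where b: "b \<in> R'" "b \<in> ball p r" using enter[of R'] R'(1) by blast
  have R'r: "R' \<in> regions V E" using R' unfolding beside_def by blast
  have off: "a \<notin> e" "b \<notin> e"
    using a b region_facts(4)[OF R] region_facts(4)[OF R'r] eE unfolding drawing_def by blast+
  obtain g where g: "arc g" "path_image g = e" using edge_arc[OF eE(1) x] by metis
  have "connected_component (- (e \<union> ?L)) a b"
  proof (rule Janiszewski[OF compact_edge[OF eE(1)] _ con])
    show "closed ?L" using compact_Union_edges[of ?D] compact_imp_closed by blast
    have "connected (- e)" using connected_arc_complement[OF g(1)] g(2) by simp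
    then show "connected_component (- e) a b"
      unfolding connected_component_def using off by (intro exI[of _ "- e"]) auto
    show "connected_component (- ?L) a b"
      unfolding connected_component_def using a b r LK by (intro exI[of _ "ball p r"]) auto
  qed
  then obtain U where U: "connected U" "U \<subseteq> - frontier R" "a \<in> U" "b \<in> U"
    unfolding connected_component_def fr by blast
  have "b \<notin> R" using regions_eqI[OF R R'r _ b(1)] R'(2) by blast
  then show False using connected_Int_frontier[of U R] U a by blast
qed

text \<open>A shortest detour around \<open>e\<close> uses only one further edge at \<open>v\<close>.  The cycle that it closes
  separates the two regions beside \<open>e\<close>, but not those beside the remaining edge at \<open>v\<close>.\<close>

lemma beside_not_all_equal:
  assumes v: "v \<in> V"
  shows "\<exists>e\<in>edges_at v. \<exists>f\<in>edges_at v. beside e \<noteq> beside f"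
proof -
  have "edges_at v \<noteq> {}" using card_edges_at_eq[OF v] by auto
  then obtain e where e: "e \<in> E" "v \<in> e" unfolding edges_at_def by blast
  obtain x where x: "e \<inter> V = {v, x}" "v \<noteq> x" using other_end[OF e(1)] e v by blast
  obtain es where es: "walk V (E - {e}) v es x"
    and shortest: "\<And>fs. walk V (E - {e}) v fs x \<Longrightarrow> length es \<le> length fs"
    using ex_has_least_nat[of "\<lambda>es. walk V (E - {e}) v es x" _ length] detour[OF e(1) x(1)] by metis
  obtain a as where as: "es = a # as" using es x(2) by (cases es) auto
  obtain y where y: "walk V (E - {e}) y as x" using es as by auto
  have noreturn: "v \<notin> f" if f: "f \<in> set as" for f
  proof
    assume "v \<in> f"
    then obtain fs where "walk V (E - {e}) v fs x" "length fs \<le> length as"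
      using walk_suffix[OF y f, of v] \<open>v \<in> f\<close> v by blast
    then show False using shortest as by fastforce
  qed
  have "card {e, a} < card (edges_at v)"
    using card_edges_at_eq[OF v] by (simp add: card_insert_if)
  then have "\<not> edges_at v \<subseteq> {e, a}" using card_mono[of "{e, a}" "edges_at v"] by auto
  then obtain f where f: "f \<in> edges_at v" "f \<noteq> e" "f \<noteq> a" by blast
  then have "f \<notin> insert e (set es)" using noreturn as unfolding edges_at_def by auto
  moreover have "set es \<subseteq> E - {e}" using walk_edges[OF es] .
  moreover have "walk V (set es) v es x" using walk_restrict[OF es] by blast
  ultimately obtain X where X: "card (beside e \<inter> X) = 1" "beside f \<subseteq> X \<or> beside f \<inter> X = {}"
    using cycle_separates_regions[OF e(1) x(1), of "set es" es] f(1) unfolding edges_at_def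
    by (metis (no_types, lifting) mem_Collect_eq)
  then have "card (beside f \<inter> X) = 2 \<or> card (beside f \<inter> X) = 0"
    using card_beside[of f] f unfolding edges_at_def by (auto simp: Int_absorb2)
  then have "beside e \<noteq> beside f" using X(1) by auto
  then show ?thesis using e f unfolding edges_at_def by blast
qed

lemma around_eq_Union_beside:
  assumes "v \<in> V"
  shows "around v = (\<Union>e\<in>edges_at v. beside e)"
  using region_has_edge_at[OF assms] unfolding around_def beside_def edges_at_def by blast

lemma beside_subset_around: "e \<in> E \<Longrightarrow> v \<in> e \<Longrightarrow> beside e \<subseteq> around v"
  unfolding beside_def around_def by blast

lemma finite_beside: "e \<in> E \<Longrightarrow> finite (beside e)"
  using card_beside by (metis card.infinite zero_neq_numeral)

lemma finite_around: "v \<in> V \<Longrightarrow> finite (around v)"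
  using around_eq_Union_beside finite_edges_at finite_beside unfolding edges_at_def by auto

text \<open>The three edges at \<open>v\<close> have six sides, and each region around \<open>v\<close> takes up at least two of
  them, which leaves at most three regions.  Two different pairs of regions beside edges at \<open>v\<close>
  account for at least three.\<close>

lemma around_structure:
  assumes v: "v \<in> V"
  shows "card (around v) = 3" "\<And>R. R \<in> around v \<Longrightarrow> card {e \<in> edges_at v. R \<in> beside e} = 2"
proof -
  let ?k = "\<lambda>R. card {e \<in> edges_at v. R \<in> beside e}"
  have fin: "finite (around v)" using finite_around[OF v] .
  have two: "2 \<le> ?k R" if R: "R \<in> around v" for R
  proof -
    obtain e where e: "e \<in> edges_at v" "R \<in> beside e" using region_has_edge_at[OF v R] by blast
    obtain f where f: "f \<in> edges_at v" "f \<noteq> e" "R \<in> beside f"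
      using region_has_second_edge_at[OF v e] by blast
    have "{e, f} \<subseteq> {e \<in> edges_at v. R \<in> beside e}" using e f by auto
    then have "card {e, f} \<le> ?k R" using finite_edges_at by (intro card_mono) auto
    then show ?thesis using f(2) by auto
  qed
  have sum6: "(\<Sum>R\<in>around v. ?k R) = 6"
  proof -
    have "(\<Sum>R\<in>around v. ?k R) = (\<Sum>e\<in>edges_at v. 2)"
    proof (rule sum_multicount_gen[OF fin finite_edges_at], intro ballI)
      fix e assume e: "e \<in> edges_at v"
      then have "{R \<in> around v. R \<in> beside e} = beside e"
        using beside_subset_around unfolding edges_at_def by blast
      then show "card {R \<in> around v. R \<in> beside e} = 2"
        using card_beside e unfolding edges_at_def by auto
    qed
    then show ?thesis using card_edges_at_eq[OF v] by simp
  qed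
  obtain e f where ef: "e \<in> edges_at v" "f \<in> edges_at v" "beside e \<noteq> beside f"
    using beside_not_all_equal[OF v] by blast
  then have efE: "e \<in> E" "f \<in> E" unfolding edges_at_def by auto
  have "3 \<le> card (around v)"
  proof -
    have "\<not> beside f \<subseteq> beside e"
      using card_subset_eq[OF finite_beside[OF efE(1)], of "beside f"] ef(3) card_beside efE by auto
    then obtain R where R: "R \<in> beside f" "R \<notin> beside e" by blast
    then have "card (insert R (beside e)) = 3" using card_beside efE finite_beside by auto
    moreover have "insert R (beside e) \<subseteq> around v"
      using beside_subset_around ef R unfolding edges_at_def by blast
    ultimately show ?thesis using card_mono[OF fin] by metis
  qed
  moreover have "2 * card (around v) \<le> 6"
    using sum_mono[of "around v" "\<lambda>_. 2" ?k] two sum6 by simp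
  ultimately show card3: "card (around v) = 3" by simp
  show "?k R = 2" if R: "R \<in> around v" for R
  proof (rule ccontr)
    assume "?k R \<noteq> 2"
    then have "2 < ?k R" using two[OF R] by simp
    then have "(\<Sum>R\<in>around v. 2) < (\<Sum>R\<in>around v. ?k R)"
      using two R fin by (intro sum_strict_mono_ex1) auto
    then show False using sum6 card3 by simp
  qed
qed

text \<open>Each of the two regions takes two of the three edges at \<open>v\<close>, so they share an edge.\<close>

lemma common_edge:
  assumes v: "v \<in> V" and R: "R \<in> around v" "R' \<in> around v" "R \<noteq> R'"
  shows "\<exists>!e. e \<in> edges_at v \<and> beside e = {R, R'}"
proof -
  let ?A = "\<lambda>R. {e \<in> edges_at v. R \<in> beside e}"
  have meet: "?A Q \<inter> ?A Q' \<noteq> {}" if "Q \<in> around v" "Q' \<in> around v" for Q Q'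
  proof
    assume "?A Q \<inter> ?A Q' = {}"
    then have "card (?A Q \<union> ?A Q') = 4"
      using card_Un_disjoint[of "?A Q" "?A Q'"] finite_edges_at around_structure(2)[OF v] that by simp
    moreover have "card (?A Q \<union> ?A Q') \<le> card (edges_at v)"
      using finite_edges_at by (intro card_mono) auto
    ultimately show False using card_edges_at_eq[OF v] by simp
  qed
  have both: "beside e = {Q, Q'}" if "e \<in> ?A Q" "e \<in> ?A Q'" "Q \<noteq> Q'" for e Q Q'
  proof (rule sym, rule card_subset_eq)
    show "finite (beside e)" "card {Q, Q'} = card (beside e)"
      using that finite_beside card_beside unfolding edges_at_def by auto
  qed (use that in auto)
  obtain e where e: "e \<in> ?A R \<inter> ?A R'" using meet[OF R(1,2)] by blast
  show ?thesis
  proof (rule ex1I[of _ e])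
    show "e \<in> edges_at v \<and> beside e = {R, R'}" using e both[of e R R'] R(3) by blast
    fix f assume f: "f \<in> edges_at v \<and> beside f = {R, R'}"
    show "f = e"
    proof (rule ccontr)
      \<comment> \<open>Two common edges would leave only one edge for the third region.\<close>
      assume "f \<noteq> e"
      have "\<not> around v \<subseteq> {R, R'}"
        using card_mono[of "{R, R'}" "around v"] around_structure(1)[OF v] R(3) by auto
      then obtain Q where Q: "Q \<in> around v" "Q \<noteq> R" "Q \<noteq> R'" by blast
      have "{e, f} = ?A R"
        using e f \<open>f \<noteq> e\<close> around_structure(2)[OF v R(1)] finite_edges_at
        by (intro card_subset_eq) simp_all
      then obtain h where "h \<in> {e, f}" "Q \<in> beside h" using meet[OF Q(1) R(1)] by blast
      then show False using e f both[of e R R'] R(3) Q by blast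
    qed
  qed
qed

lemma handshake:
  assumes "D \<subseteq> E"
  shows "(\<Sum>v\<in>V. card {e \<in> D. v \<in> e}) = 2 * card D"
proof -
  have "(\<Sum>v\<in>V. card {e \<in> D. v \<in> e}) = (\<Sum>e\<in>D. 2)"
  proof (rule sum_multicount_gen[OF finite_V], use assms finite_E finite_subset in blast, intro ballI)
    fix e assume "e \<in> D"
    moreover have "{v \<in> V. v \<in> e} = e \<inter> V" by auto
    ultimately show "card {v \<in> V. v \<in> e} = 2" using card_edge_ends assms by auto
  qed
  then show ?thesis by simp
qed

lemma handshake_regular:
  assumes "D \<subseteq> E" "A \<subseteq> V" "\<And>v. v \<in> A \<Longrightarrow> card {e \<in> D. v \<in> e} = k"
    and "\<And>e v. e \<in> D \<Longrightarrow> v \<in> e \<inter> V \<Longrightarrow> v \<in> A"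
  shows "k * card A = 2 * card D"
proof -
  have "card {e \<in> D. v \<in> e} = (if v \<in> A then k else 0)" if "v \<in> V" for v
  proof (cases "v \<in> A")
    case False
    then have none: "{e \<in> D. v \<in> e} = {}" using assms(4) that by blast
    show ?thesis unfolding none using False by simp
  qed (use assms(3) in simp)
  then have "2 * card D = (\<Sum>v\<in>V. if v \<in> A then k else 0)"
    using handshake[OF assms(1)] by simp
  also have "\<dots> = k * card A"
    using sum.inter_restrict[OF finite_V, of "\<lambda>_. k" A] Int_absorb1[OF assms(2)]
    by (simp add: mult.commute)
  finally show ?thesis by simp
qed

definition corners :: "complex set \<Rightarrow> complex set" where
  "corners R = V \<inter> frontier R"

lemma in_corners_iff: "R \<in> regions V E \<Longrightarrow> v \<in> corners R \<longleftrightarrow> v \<in> V \<and> R \<in> around v"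
  unfolding corners_def around_def by auto

text \<open>Both count the incidences of corners and sides of \<open>R\<close>, up to the factor 2.\<close>

lemma sides_eq_card_corners:
  assumes R: "R \<in> regions V E"
  shows "sides E R = card (corners R)"
proof -
  let ?D = "{e \<in> E. R \<in> beside e}"
  have "2 * card (corners R) = 2 * card ?D"
  proof (rule handshake_regular)
    fix v assume "v \<in> corners R"
    then have v: "v \<in> V" "R \<in> around v" using in_corners_iff[OF R] by auto
    have "{e \<in> ?D. v \<in> e} = {e \<in> edges_at v. R \<in> beside e}" unfolding edges_at_def by auto
    then show "card {e \<in> ?D. v \<in> e} = 2" using around_structure(2)[OF v] by simp
  next
    fix e v assume "e \<in> ?D" "v \<in> e \<inter> V"
    then show "v \<in> corners R" unfolding beside_def corners_def by blast
  qed (auto simp: corners_def)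
  moreover have "{e \<in> E. e \<subseteq> frontier R} = ?D" using R unfolding beside_def by auto
  ultimately show ?thesis unfolding sides_def by simp
qed

text \<open>Every common corner is an end of exactly one common edge.\<close>

lemma even_common_corners:
  assumes R: "R \<in> regions V E" "R' \<in> regions V E" "R \<noteq> R'"
  shows "even (card (corners R \<inter> corners R'))"
proof -
  let ?D = "{e \<in> E. beside e = {R, R'}}"
  have "1 * card (corners R \<inter> corners R') = 2 * card ?D"
  proof (rule handshake_regular)
    fix v assume "v \<in> corners R \<inter> corners R'"
    then have v: "v \<in> V" "R \<in> around v" "R' \<in> around v" using in_corners_iff R by auto
    have "\<exists>!e. e \<in> {e \<in> ?D. v \<in> e}"
      using common_edge[OF v R(3)] unfolding edges_at_def by (simp add: conj_ac)
    then show "card {e \<in> ?D. v \<in> e} = 1" by (metis (no_types, lifting) is_singletonI' is_singleton_altdef ex_in_conv)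
  next
    fix e v assume "e \<in> ?D" "v \<in> e \<inter> V"
    then show "v \<in> corners R \<inter> corners R'" unfolding beside_def corners_def by blast
  qed (auto simp: corners_def)
  then show ?thesis by simp
qed

lemma region_has_corner:
  assumes R: "R \<in> regions V E"
  shows "\<exists>v\<in>V. R \<in> around v"
proof -
  have "R \<noteq> UNIV" using region_facts(4)[OF R] V_nonempty unfolding drawing_def by blast
  then have "frontier R \<noteq> {}" using frontier_eq_empty region_facts(3)[OF R] by blast
  then obtain e where e: "e \<in> E" "R \<in> beside e" using frontier_eq_Union_edges[OF R] by blast
  obtain v x where "e \<inter> V = {v, x}" using edge_ends[OF e(1)] by metis
  then show ?thesis using e(2) unfolding around_def beside_def by blast
qed

lemma finite_regions: "finite (regions V E)"
proof -
  have "regions V E \<subseteq> (\<Union>v\<in>V. around v)" using region_has_corner by blast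
  then show ?thesis using finite_V finite_around finite_subset by blast
qed

text \<open>The frontier of a region of a connected drawing is connected, hence so is the subgraph that it
  carries.\<close>

lemma frontier_walk:
  assumes R: "R \<in> regions V E" and u: "u \<in> corners R" and w: "w \<in> corners R"
  shows "\<exists>es. walk V {e \<in> E. R \<in> beside e} u es w"
proof (rule ccontr)
  let ?D = "{e \<in> E. R \<in> beside e}"
  let ?A = "{e \<in> ?D. \<exists>es. \<exists>x\<in>e. walk V ?D u es x}"
  assume no: "\<not> ?thesis"
  have fr: "frontier R = \<Union>?D" using frontier_eq_Union_edges[OF R] .
  have uV: "u \<in> V" "w \<in> V" using u w unfolding corners_def by auto
  have all: "\<exists>es. walk V ?D u es x" if e: "e \<in> ?A" "x \<in> e \<inter> V" for e x
  proof -
    obtain es y where y: "y \<in> e" "walk V ?D u es y" using e by blast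
    then have "y \<in> e \<inter> V" using walk_ends by blast
    then obtain z where z: "e \<inter> V = {y, z}" using other_end[of e y] e by blast
    then have "x = y \<or> x = z" using e by blast
    moreover have "walk V ?D u (es @ [e]) z" using y z e by (auto simp: walk_append intro!: exI[of _ y])
    ultimately show ?thesis using y by blast
  qed
  have closed: "closed (\<Union>B)" if "B \<subseteq> ?D" for B
    using compact_Union_edges[of B] that compact_imp_closed by blast
  have cl: "closed (\<Union>?A)" "closed (\<Union>(?D - ?A))" by (rule closed; blast)+
  have cover: "frontier R \<subseteq> \<Union>?A \<union> \<Union>(?D - ?A)" unfolding fr by blast
  have disj: "\<Union>?A \<inter> \<Union>(?D - ?A) \<inter> frontier R = {}"
  proof (rule ccontr)
    assume "\<Union>?A \<inter> \<Union>(?D - ?A) \<inter> frontier R \<noteq> {}"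
    then obtain p e f where p: "e \<in> ?A" "f \<in> ?D - ?A" "p \<in> e" "p \<in> f" by blast
    then have "p \<in> V" using edges_meet[of e f] by blast
    then have "\<exists>es. walk V ?D u es p" using all[OF p(1)] p by blast
    then show False using p by blast
  qed
  have uA: "u \<in> \<Union>?A"
  proof -
    obtain e where e: "e \<in> ?D" "u \<in> e" using u fr unfolding corners_def by blast
    moreover have "walk V ?D u [] u" using uV by simp
    ultimately show ?thesis by blast
  qed
  have wA: "w \<in> \<Union>(?D - ?A)"
  proof -
    obtain e where e: "e \<in> ?D" "w \<in> e" using w fr unfolding corners_def by blast
    then have "e \<notin> ?A" using all[of e w] no uV by blast
    then show ?thesis using e by blast
  qed
  have "u \<in> frontier R" "w \<in> frontier R" using u w unfolding corners_def by auto
  then have "\<Union>?A \<inter> frontier R \<noteq> {}" "\<Union>(?D - ?A) \<inter> frontier R \<noteq> {}" using uA wA by blast+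
  then show False using connected_closedD[OF region_facts(6)[OF R] disj cover cl] by simp
qed

end

section \<open>Counting over the field with two elements\<close>

text \<open>Vectors over the field with two elements are written as finite sets, with the symmetric
  difference as addition and the parity of the intersection as inner product.\<close>

lemma odd_card_sym_diff:
  assumes "finite A" "finite B"
  shows "odd (card (sym_diff A B)) \<longleftrightarrow> odd (card A) \<noteq> odd (card B)"
proof -
  have "card (sym_diff A B) = card (A - B) + card (B - A)"
    using assms by (intro card_Un_disjoint) auto
  moreover have "card A = card (A - B) + card (A \<inter> B)" "card B = card (B - A) + card (A \<inter> B)"
    using assms card_Int_Diff[of A B] card_Int_Diff[of B A] by (auto simp: Int_commute)
  ultimately show ?thesis by presburger
qed

lemma odd_card_Int_sym_diff:
  assumes "finite C"
  shows "odd (card (C \<inter> sym_diff A B)) \<longleftrightarrow> odd (card (C \<inter> A)) \<noteq> odd (card (C \<inter> B))"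
proof -
  have "C \<inter> sym_diff A B = sym_diff (C \<inter> A) (C \<inter> B)" by blast
  then show ?thesis using odd_card_sym_diff[of "C \<inter> A" "C \<inter> B"] assms by simp
qed

text \<open>All nonempty fibres are translates of the kernel.\<close>

lemma card_kernel_times_card_image:
  assumes fin: "finite A"
    and hom: "\<And>X Y. X \<subseteq> A \<Longrightarrow> Y \<subseteq> A \<Longrightarrow> h (sym_diff X Y) = sym_diff (h X) (h Y)"
  shows "card {X. X \<subseteq> A \<and> h X = {}} * card (h ` Pow A) = 2 ^ card A"
proof -
  have fibre: "card {X \<in> Pow A. h X = y} = card {X. X \<subseteq> A \<and> h X = {}}" if y: "y \<in> h ` Pow A" for y
  proof -
    obtain X0 where X0: "X0 \<subseteq> A" "h X0 = y" using y by blast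
    have "bij_betw (\<lambda>X. sym_diff X X0) {X \<in> Pow A. h X = y} {X. X \<subseteq> A \<and> h X = {}}"
      by (rule bij_betw_byWitness[where f' = "\<lambda>X. sym_diff X X0"])
        (use X0 hom in auto)
    then show ?thesis by (rule bij_betw_same_card)
  qed
  have "2 ^ card A = card (Pow A)" using fin by (simp add: card_Pow)
  also have "\<dots> = (\<Sum>y\<in>h ` Pow A. card {X \<in> Pow A. h X = y})"
    using sum.image_gen[of "Pow A" "\<lambda>_. 1::nat" h] fin by simp
  also have "\<dots> = (\<Sum>y\<in>h ` Pow A. card {X. X \<subseteq> A \<and> h X = {}})"
    using fibre by (intro sum.cong) auto
  finally show ?thesis by (simp add: mult.commute)
qed

text \<open>Adding \<open>g\<close> permutes the summands and changes all signs.\<close>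

lemma sum_signs_eq_0:
  assumes "finite x" and closed: "\<And>a. a \<in> G \<Longrightarrow> sym_diff g a \<in> G" and g: "odd (card (x \<inter> g))"
  shows "(\<Sum>a\<in>G. (- 1) ^ card (x \<inter> a)) = (0::int)"
proof -
  have "bij_betw (sym_diff g) G G"
  proof (rule bij_betw_byWitness[where f' = "sym_diff g"])
    show "\<forall>a\<in>G. sym_diff g (sym_diff g a) = a" by blast
  qed (use closed in auto)
  then have "(\<Sum>a\<in>G. (- 1) ^ card (x \<inter> a)) = (\<Sum>a\<in>G. (- 1) ^ card (x \<inter> sym_diff g a) :: int)"
    by (rule sum.reindex_bij_betw[symmetric])
  also have "\<dots> = (\<Sum>a\<in>G. - ((- 1) ^ card (x \<inter> a)))"
    using odd_card_Int_sym_diff[OF assms(1), of g] g by (intro sum.cong) (auto simp: minus_one_power_iff)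
  also have "\<dots> = - (\<Sum>a\<in>G. (- 1) ^ card (x \<inter> a))" by (rule sum_negf)
  finally show ?thesis by simp
qed

text \<open>Sum \<open>(- 1) ^ card (x \<inter> w)\<close> over all \<open>x \<subseteq> U\<close> and \<open>w \<in> W\<close>.  Summing over \<open>x\<close> first, only \<open>w = {}\<close>
  contributes, and the total is \<open>2 ^ card U\<close>.  Summing over \<open>w\<close> first, each \<open>x\<close> orthogonal to \<open>W\<close>
  contributes \<open>card W\<close> and the others nothing; the members of \<open>W\<close> are orthogonal to \<open>W\<close>.  In other
  words, a totally isotropic subspace has at most half the dimension of the whole space.\<close>

lemma card_isotropic:
  assumes fin: "finite U" and W: "W \<subseteq> Pow U" "{} \<in> W"
    and closed: "\<And>a b. a \<in> W \<Longrightarrow> b \<in> W \<Longrightarrow> sym_diff a b \<in> W"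
    and isotropic: "\<And>a b. a \<in> W \<Longrightarrow> b \<in> W \<Longrightarrow> even (card (a \<inter> b))"
  shows "card W * card W \<le> 2 ^ card U"
proof -
  have finW: "finite W" using W fin finite_subset by blast
  let ?s = "\<lambda>x w. (- 1) ^ card (x \<inter> w) :: int"
  have "(\<Sum>w\<in>W. \<Sum>x\<in>Pow U. ?s x w) = (\<Sum>w\<in>W. if w = {} then 2 ^ card U else 0)"
  proof (rule sum.cong[OF refl])
    fix w assume w: "w \<in> W"
    show "(\<Sum>x\<in>Pow U. ?s x w) = (if w = {} then 2 ^ card U else 0)"
    proof (cases "w = {}")
      case True
      then show ?thesis using fin by (simp add: card_Pow)
    next
      case False
      then obtain v where v: "v \<in> w" by blast
      then have "w \<inter> {v} = {v}" by blast
      have "(\<Sum>x\<in>Pow U. ?s w x) = 0"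
      proof (rule sum_signs_eq_0[where g = "{v}"])
        show "finite w" using w W fin finite_subset by blast
        show "sym_diff {v} a \<in> Pow U" if "a \<in> Pow U" for a using that v w W by blast
        show "odd (card (w \<inter> {v}))" unfolding \<open>w \<inter> {v} = {v}\<close> by simp
      qed
      then show ?thesis using False by (simp add: Int_commute)
    qed
  qed
  also have "\<dots> = 2 ^ card U" using finW W(2) by simp
  finally have "2 ^ card U = (\<Sum>x\<in>Pow U. \<Sum>w\<in>W. ?s x w)"
    using sum.swap[of "\<lambda>w x. ?s x w" "Pow U" W] by simp
  also have "\<dots> \<ge> (\<Sum>x\<in>W. \<Sum>w\<in>W. ?s x w)"
  proof (rule sum_mono2)
    show "finite (Pow U)" "W \<subseteq> Pow U" using fin W by auto
    fix x assume "x \<in> Pow U - W"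
    then have finx: "finite x" using fin finite_subset by blast
    show "0 \<le> (\<Sum>w\<in>W. ?s x w)"
    proof (cases "\<exists>g\<in>W. odd (card (x \<inter> g))")
      case True
      then obtain g where g: "g \<in> W" "odd (card (x \<inter> g))" by blast
      have "(\<Sum>w\<in>W. ?s x w) = 0"
        by (rule sum_signs_eq_0[OF finx closed[OF g(1)] g(2)])
      then show ?thesis by simp
    next
      case False
      then show ?thesis by (intro sum_nonneg) (auto simp: minus_one_power_iff)
    qed
  qed
  also have "(\<Sum>x\<in>W. \<Sum>w\<in>W. ?s x w) = (\<Sum>x\<in>W. \<Sum>w\<in>W. 1)"
    using isotropic by (intro sum.cong) (auto simp: minus_one_power_iff)
  finally have "int (card W * card W) \<le> int (2 ^ card U)" by simp
  then show ?thesis by (simp only: of_nat_le_iff)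
qed

lemma card_eq_1_if_ex1: "\<exists>!x. P x \<Longrightarrow> card {x. P x} = 1"
proof -
  assume "\<exists>!x. P x"
  then obtain x where "{x. P x} = {x}" by blast
  then show ?thesis by simp
qed

section \<open>Euler's inequality\<close>

lemma walk_leaves_set:
  assumes "walk V E v es w" "v \<in> A" "w \<notin> A"
  shows "\<exists>e\<in>E. \<exists>a\<in>A. \<exists>b\<in>V - A. e \<inter> V = {a, b}"
  using assms
proof (induction es arbitrary: v)
  case (Cons e es)
  then obtain x where x: "e \<in> E" "e \<inter> V = {v, x}" "walk V E x es w" by auto
  show ?case
  proof (cases "x \<in> A")
    case True
    then show ?thesis using Cons x by blast
  next
    case False
    then show ?thesis using x Cons.prems by blast
  qed
qed auto

context cubic_plane_graph
begin

text \<open>The tree is grown vertex by vertex, along edges that leave the part already reached.\<close>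

lemma spanning_tree:
  obtains T where "T \<subseteq> E" "card T < card V" "\<And>v w. v \<in> V \<Longrightarrow> w \<in> V \<Longrightarrow> \<exists>es. walk V T v es w"
proof -
  obtain v0 where v0: "v0 \<in> V" using V_nonempty by blast
  have "k \<le> card V \<Longrightarrow> 0 < k \<Longrightarrow> \<exists>A T. A \<subseteq> V \<and> card A = k \<and> v0 \<in> A \<and> T \<subseteq> E \<and> card T < k \<and>
      (\<forall>v\<in>A. \<exists>es. walk V T v0 es v)" for k
  proof (induction k)
    case (Suc k)
    show ?case
    proof (cases "k = 0")
      case True
      then show ?thesis using v0
        by (intro exI[of _ "{v0}"] exI[of _ "{}"]) (auto intro: exI[of _ "[]"])
    next
      case False
      then obtain A T where IH: "A \<subseteq> V" "card A = k" "v0 \<in> A" "T \<subseteq> E" "card T < k"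
        "\<forall>v\<in>A. \<exists>es. walk V T v0 es v" using Suc by auto
      have "A \<noteq> V" using IH(2) Suc.prems by auto
      then obtain w where w: "w \<in> V" "w \<notin> A" using IH(1) by blast
      obtain es where "walk V E v0 es w" using walk_exists[OF v0 w(1)] by blast
      from walk_leaves_set[OF this IH(3) w(2)] obtain e a b
        where e: "e \<in> E" "a \<in> A" "b \<in> V - A" "e \<inter> V = {a, b}" by blast
      have "\<exists>fs. walk V (insert e T) v0 fs v" if v: "v \<in> insert b A" for v
      proof (cases "v = b")
        case True
        obtain fs where "walk V T v0 fs a" using IH(6) e(2) by blast
        then have "walk V (insert e T) v0 fs a" by (rule walk_mono) blast
        moreover have "walk V (insert e T) a [e] b" using e by (auto simp: e(4))
        ultimately have "walk V (insert e T) v0 (fs @ [e]) v" unfolding walk_append True by blast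
        then show ?thesis by blast
      next
        case False
        then obtain fs where "walk V T v0 fs v" using IH(6) v by blast
        then have "walk V (insert e T) v0 fs v" by (rule walk_mono) blast
        then show ?thesis by blast
      qed
      moreover have "card (insert b A) = Suc k"
        using e(3) IH(1,2) finite_subset[OF _ finite_V] by auto
      moreover have "card (insert e T) < Suc k"
        using IH(4,5) finite_subset[OF _ finite_E] by (simp add: card_insert_if)
      ultimately show ?thesis using IH(1,3,4) e(1,3)
        by (intro exI[of _ "insert b A"] exI[of _ "insert e T"]) auto
    qed
  qed simp
  moreover have "0 < card V" using V_nonempty finite_V by (simp add: card_gt_0_iff)
  ultimately obtain A T where T: "A \<subseteq> V" "card A = card V" "v0 \<in> A" "T \<subseteq> E" "card T < card V"
      "\<forall>v\<in>A. \<exists>es. walk V T v0 es v" by blast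
  have AV: "A = V" using T(1,2) finite_V by (intro card_subset_eq) auto
  show ?thesis
  proof (rule that[OF T(4,5)])
    fix v w assume "v \<in> V" "w \<in> V"
    then obtain es fs where "walk V T v0 es v" "walk V T v0 fs w" using T(6) AV by blast
    then have "walk V T v (rev es @ fs) w" using walk_rev walk_append by blast
    then show "\<exists>es. walk V T v es w" by blast
  qed
qed

text \<open>Each edge off a spanning tree closes a cycle through no other such edge, and the regions
  inside that cycle are separated from those outside by this edge but by no other edge off the tree.
  So sets of regions realise every set of such edges as the set of separating ones; the empty set
  is realised both by no region and by all regions.\<close>

lemma Euler_inequality: "card E + 2 \<le> card V + card (regions V E)"
proof -
  obtain T where T: "T \<subseteq> E" "card T < card V" "\<And>v w. v \<in> V \<Longrightarrow> w \<in> V \<Longrightarrow> \<exists>es. walk V T v es w"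
    using spanning_tree by blast
  let ?F = "regions V E"
  define h where "h X = {f \<in> E - T. odd (card (beside f \<inter> X))}" for X
  have hom: "h (sym_diff X Y) = sym_diff (h X) (h Y)" for X Y
    unfolding h_def using odd_card_Int_sym_diff finite_beside by auto
  have unit: "{e} \<in> h ` Pow ?F" if e: "e \<in> E - T" for e
  proof -
    obtain v x where vx: "e \<inter> V = {v, x}" using edge_ends[of e] e by blast
    then obtain es where "walk V T v es x" using T(3) by blast
    moreover have "T \<subseteq> E - {e}" using T(1) e by blast
    ultimately obtain X where X: "X \<subseteq> ?F" "card (beside e \<inter> X) = 1"
      "\<And>f. f \<in> E \<Longrightarrow> f \<notin> insert e T \<Longrightarrow> beside f \<subseteq> X \<or> beside f \<inter> X = {}"
      using cycle_separates_regions[of e v x T es] vx e by blast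
    have "even (card (beside f \<inter> X))" if "f \<in> E - T" "f \<noteq> e" for f
      using X(3)[of f] that card_beside[of f] by (auto simp: Int_absorb2)
    then have "h X = {e}" unfolding h_def using e X(2) by auto
    then show ?thesis using X(1) by blast
  qed
  have "S \<in> h ` Pow ?F" if "S \<subseteq> E - T" for S
  proof -
    have "finite S" using that finite_E finite_subset by blast
    then show ?thesis using that
    proof (induction S)
      case empty
      have "h {} = {}" unfolding h_def by simp
      then show ?case by (metis Pow_bottom imageI)
    next
      case (insert e S)
      obtain X where X: "X \<subseteq> ?F" "h X = {e}" using unit[of e] insert.prems by auto
      obtain Y where Y: "Y \<subseteq> ?F" "h Y = S" using insert by auto
      have "h (sym_diff X Y) = insert e S" unfolding hom X(2) Y(2) using insert.hyps by blast
      moreover have "sym_diff X Y \<in> Pow ?F" using X Y by blast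
      ultimately show ?case by (metis imageI)
    qed
  qed
  then have img: "h ` Pow ?F = Pow (E - T)" unfolding h_def by blast
  have "?F \<noteq> {}"
  proof -
    obtain v where "v \<in> V" using V_nonempty by blast
    then show ?thesis using around_structure(1)[of v] unfolding around_def by (metis (no_types, lifting)
          card.empty empty_Collect_eq empty_iff zero_neq_numeral)
  qed
  have "h ?F = {}"
  proof -
    have "beside f \<inter> ?F = beside f" for f unfolding beside_def by blast
    then show ?thesis unfolding h_def using card_beside by auto
  qed
  then have "{{}, ?F} \<subseteq> {X. X \<subseteq> ?F \<and> h X = {}}" unfolding h_def by auto
  then have "card {{}, ?F} \<le> card {X. X \<subseteq> ?F \<and> h X = {}}"
    using finite_regions by (intro card_mono) auto
  then have ker: "2 \<le> card {X. X \<subseteq> ?F \<and> h X = {}}" using \<open>?F \<noteq> {}\<close> by simp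
  have "card {X. X \<subseteq> ?F \<and> h X = {}} * card (h ` Pow ?F) = 2 ^ card ?F"
    by (rule card_kernel_times_card_image[OF finite_regions hom])
  moreover have "card (h ` Pow ?F) = 2 ^ card (E - T)"
    unfolding img using finite_E by (simp add: card_Pow)
  ultimately have "(2::nat) ^ Suc (card (E - T)) \<le> 2 ^ card ?F"
    using mult_le_mono1[OF ker, of "2 ^ card (E - T)"] by simp
  then have "Suc (card (E - T)) \<le> card ?F" by (simp only: power_increasing_iff)
  moreover have "card (E - T) = card E - card T"
    using T(1) finite_E finite_subset by (intro card_Diff_subset) auto
  ultimately show ?thesis using T(2) by linarith
qed

lemma card_edges: "3 * card V = 2 * card E"
proof (rule handshake_regular)
  fix v assume "v \<in> V"
  then show "card {e \<in> E. v \<in> e} = 3" by (rule card_edges_at)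
qed auto

lemma regions_lower_bound: "card V + 4 \<le> 2 * card (regions V E)"
  using Euler_inequality card_edges by linarith

section \<open>Sets of regions that change nothing\<close>

text \<open>A crossing change on each region of \<open>X\<close> switches exactly the vertices in \<open>changed X\<close>, so this is
  the linear map whose cosets are the classes of states and whose kernel has to be counted.\<close>

definition changed :: "complex set set \<Rightarrow> complex set" where
  "changed X = {v \<in> V. odd (card (around v \<inter> X))}"

definition neutral :: "complex set set \<Rightarrow> bool" where
  "neutral X \<longleftrightarrow> X \<subseteq> regions V E \<and> changed X = {}"

lemma changed_sym_diff: "changed (sym_diff X Y) = sym_diff (changed X) (changed Y)"
  unfolding changed_def using odd_card_Int_sym_diff finite_around by auto

lemma changed_empty: "changed {} = {}"
  unfolding changed_def by simp

lemma changed_singleton: "R \<in> regions V E \<Longrightarrow> changed {R} = corners R"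
proof -
  assume R: "R \<in> regions V E"
  have "odd (card (around v \<inter> {R})) \<longleftrightarrow> R \<in> around v" for v
    by (cases "R \<in> around v") auto
  then show ?thesis unfolding changed_def using in_corners_iff[OF R] by auto
qed

lemma changed_insert:
  assumes "R \<in> regions V E" "R \<notin> X"
  shows "changed (insert R X) = sym_diff (corners R) (changed X)"
proof -
  have "insert R X = sym_diff {R} X" using assms(2) by blast
  then show ?thesis using changed_sym_diff[of "{R}" X] changed_singleton[OF assms(1)] by simp
qed

lemma neutral_even_around: "neutral X \<Longrightarrow> v \<in> V \<Longrightarrow> even (card (around v \<inter> X))"
  unfolding neutral_def changed_def by blast

text \<open>By parity \<open>X\<close> contains no region around \<open>v\<close>.  Along an edge only one new region appears around
  the next vertex, so by parity that one is excluded as well, and the graph is connected.\<close>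

lemma neutral_avoiding_vertex:
  assumes X: "neutral X" and v: "v \<in> V" "card (around v \<inter> X) \<le> 1"
  shows "X = {}"
proof -
  have none: "around w \<inter> X = {}" if "w \<in> V" "card (around w \<inter> X) \<le> 1" for w
  proof -
    have "card (around w \<inter> X) = 0"
      using neutral_even_around[OF X that(1)] that(2) by (cases "card (around w \<inter> X)") auto
    then show ?thesis using finite_around[OF that(1)] by simp
  qed
  have step: "around w \<inter> X = {}" if "walk V E u es w" "around u \<inter> X = {}" for u es w
    using that
  proof (induction es arbitrary: u)
    case (Cons e es)
    then obtain x where x: "e \<in> E" "e \<inter> V = {u, x}" "walk V E x es w" by auto
    then have xV: "x \<in> V" "x \<in> e" "u \<in> e" by auto
    have "beside e \<inter> X = {}" using beside_subset_around[OF x(1) xV(3)] Cons.prems(2) by blast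
    then have "around x \<inter> X \<subseteq> around x - beside e" by blast
    then have "card (around x \<inter> X) \<le> card (around x - beside e)"
      using finite_around[OF xV(1)] by (intro card_mono) auto
    also have "\<dots> = 1"
      using beside_subset_around[OF x(1) xV(2)] finite_beside[OF x(1)] card_beside[OF x(1)]
        around_structure(1)[OF xV(1)] by (simp add: card_Diff_subset)
    finally show ?case using Cons.IH[OF x(3)] none[OF xV(1)] by blast
  qed simp
  show ?thesis
  proof (rule ccontr)
    assume "X \<noteq> {}"
    then obtain R where R: "R \<in> X" by blast
    then obtain w where w: "w \<in> V" "R \<in> around w"
      using region_has_corner X unfolding neutral_def by blast
    obtain es where "walk V E v es w" using walk_exists v(1) w(1) by blast
    from step[OF this none[OF v]] show False using R w by blast
  qed
qed

lemma neutral_two_around: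
  assumes X: "neutral X" "X \<noteq> {}" and v: "v \<in> V"
  shows "card (around v \<inter> X) = 2"
proof -
  have "card (around v \<inter> X) \<le> 3"
    using card_mono[OF finite_around[OF v], of "around v \<inter> X"] around_structure(1)[OF v] by simp
  moreover have "\<not> card (around v \<inter> X) \<le> 1" using neutral_avoiding_vertex[OF X(1) v] X(2) by blast
  moreover have "card (around v \<inter> X) \<noteq> 3" using neutral_even_around[OF X(1) v] by auto
  ultimately show ?thesis by linarith
qed

text \<open>Around a member \<open>R\<close> of a neutral set, every corner of \<open>R\<close> lies on exactly one of those sides of
  \<open>R\<close> beyond which there is another member; so these sides pair off the corners.\<close>

lemma neutral_members_even:
  assumes X: "neutral X" and R: "R \<in> X"
  shows "\<not> odd_region E R"
proof -
  have Rr: "R \<in> regions V E" using X R unfolding neutral_def by blast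
  let ?D = "{e \<in> E. R \<in> beside e \<and> beside e \<subseteq> X}"
  have "1 * card (corners R) = 2 * card ?D"
  proof (rule handshake_regular)
    fix v assume "v \<in> corners R"
    then have v: "v \<in> V" "R \<in> around v" using in_corners_iff[OF Rr] by auto
    have "card (around v \<inter> X) = 2" using neutral_two_around[OF X _ v(1)] R by blast
    then obtain R' where R': "around v \<inter> X = {R, R'}" "R \<noteq> R'"
    proof -
      obtain A B where AB: "around v \<inter> X = {A, B}" "A \<noteq> B"
        using \<open>card (around v \<inter> X) = 2\<close> by (meson card_2_iff)
      moreover have "R = A \<or> R = B" using AB(1) v(2) R by blast
      ultimately show ?thesis using that[of A] that[of B] by (metis insert_commute)
    qed
    have "e \<in> ?D \<and> v \<in> e \<longleftrightarrow> e \<in> edges_at v \<and> beside e = {R, R'}" for e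
    proof
      assume e: "e \<in> ?D \<and> v \<in> e"
      then have "beside e \<subseteq> {R, R'}" using beside_subset_around[of e v] R'(1) by blast
      then have "beside e = {R, R'}"
        using card_beside[of e] e R'(2) by (intro card_subset_eq) auto
      then show "e \<in> edges_at v \<and> beside e = {R, R'}" using e unfolding edges_at_def by blast
    next
      assume "e \<in> edges_at v \<and> beside e = {R, R'}"
      then show "e \<in> ?D \<and> v \<in> e" using R' unfolding edges_at_def by blast
    qed
    then have "{e \<in> ?D. v \<in> e} = {e. e \<in> edges_at v \<and> beside e = {R, R'}}" by blast
    moreover have "\<exists>!e. e \<in> edges_at v \<and> beside e = {R, R'}"
    proof (rule common_edge[OF v(1,2) _ R'(2)])
      show "R' \<in> around v" using R'(1) by blast
    qed
    then have "card {e. e \<in> edges_at v \<and> beside e = {R, R'}} = 1" by (rule card_eq_1_if_ex1)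
    ultimately show "card {e \<in> ?D. v \<in> e} = 1" by simp
  next
    fix e v assume "e \<in> ?D" "v \<in> e \<inter> V"
    then show "v \<in> corners R" unfolding beside_def corners_def by blast
  qed (auto simp: corners_def)
  then show ?thesis unfolding odd_region_def sides_eq_card_corners[OF Rr] by simp
qed

text \<open>The symmetric difference of \<open>X\<close> and \<open>Y\<close> is neutral and has at most one member around \<open>v\<close>.\<close>

lemma neutral_determined:
  assumes X: "neutral X" and Y: "neutral Y" and v: "v \<in> V"
    and eq: "\<And>Q. Q \<in> around v \<Longrightarrow> Q \<noteq> R \<Longrightarrow> Q \<in> X \<longleftrightarrow> Q \<in> Y"
  shows "X = Y"
proof -
  let ?Z = "sym_diff X Y"
  have "neutral ?Z"
    using X Y changed_sym_diff[of X Y] unfolding neutral_def by auto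
  moreover have "card (around v \<inter> ?Z) \<le> 1"
    using card_mono[of "{R}" "around v \<inter> ?Z"] eq by auto
  ultimately have "?Z = {}" using neutral_avoiding_vertex v by blast
  then show ?thesis by blast
qed

lemma card_neutral_le_4: "card {X. neutral X} \<le> 4"
proof -
  obtain v where v: "v \<in> V" using V_nonempty by blast
  then have "around v \<noteq> {}" using around_structure(1) by fastforce
  then obtain R where R: "R \<in> around v" by blast
  let ?h = "\<lambda>X. X \<inter> (around v - {R})"
  have "inj_on ?h {X. neutral X}"
  proof (rule inj_onI)
    fix X Y assume "X \<in> {X. neutral X}" "Y \<in> {X. neutral X}" "?h X = ?h Y"
    then show "X = Y" by (intro neutral_determined[OF _ _ v, of X Y R]) blast+
  qed
  then have "card {X. neutral X} \<le> card (Pow (around v - {R}))"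
    using finite_around[OF v] by (intro card_inj_on_le) auto
  also have "\<dots> = 4" using finite_around[OF v] R around_structure(1)[OF v] by (simp add: card_Pow)
  finally show ?thesis .
qed

lemma neutral_empty: "neutral {}"
  unfolding neutral_def changed_def by simp

lemma card_neutral_times_card_changed:
  "card {X. neutral X} * card (changed ` Pow (regions V E)) = 2 ^ card (regions V E)"
  unfolding neutral_def
  by (rule card_kernel_times_card_image[OF finite_regions changed_sym_diff])

lemma empty_in_image_changed: "{} \<in> changed ` Pow (regions V E)"
  using changed_empty by (metis Pow_bottom imageI)

lemma image_changed_closed:
  assumes "a \<in> changed ` Pow (regions V E)" "b \<in> changed ` Pow (regions V E)"
  shows "sym_diff a b \<in> changed ` Pow (regions V E)"
proof -
  obtain X Y where XY: "X \<subseteq> regions V E" "Y \<subseteq> regions V E" "a = changed X" "b = changed Y"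
    using assms by blast
  then have "sym_diff a b = changed (sym_diff X Y)" using changed_sym_diff by simp
  moreover have "sym_diff X Y \<in> Pow (regions V E)" using XY by blast
  ultimately show ?thesis by (metis imageI)
qed

lemma card_changed_pos: "card (changed ` Pow (regions V E)) > 0"
  using finite_regions by (auto simp: card_gt_0_iff)

text \<open>When all regions are even, the sets of corners of the regions are pairwise orthogonal and
  orthogonal to themselves, so they span at most half the dimension of the space of all sets of
  vertices.  Euler's inequality then leaves room for at least four neutral sets.\<close>

lemma all_even_card_neutral:
  assumes even: "\<And>R. R \<in> regions V E \<Longrightarrow> \<not> odd_region E R"
  shows "card {X. neutral X} = 4"
proof -
  let ?F = "regions V E"
  let ?W = "changed ` Pow ?F"
  have finC: "finite (changed X)" for X unfolding changed_def using finite_V by simp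
  have finX: "finite X" if "X \<subseteq> ?F" for X using that finite_regions finite_subset by blast
  have corners2: "even (card (corners R \<inter> corners Q))" if "R \<in> ?F" "Q \<in> ?F" for R Q
    using even_common_corners[OF that] even[OF that(1)] sides_eq_card_corners[OF that(1)]
    unfolding odd_region_def by (cases "R = Q") auto
  have corners1: "even (card (corners R \<inter> changed Y))" if R: "R \<in> ?F" and Y: "Y \<subseteq> ?F" for R Y
    using finX[OF Y] Y
  proof (induction Y)
    case empty
    then show ?case by (simp add: changed_empty)
  next
    case (insert Q Y)
    have "finite (corners R)" unfolding corners_def using finite_V by simp
    then show ?case
      using odd_card_Int_sym_diff[of "corners R" "corners Q" "changed Y"] insert corners2[OF R, of Q]
        changed_insert[of Q Y] by auto
  qed
  have ortho: "even (card (changed Y \<inter> changed X))" if Y: "Y \<subseteq> ?F" and X: "X \<subseteq> ?F" for X Y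
    using finX[OF X] X
  proof (induction X)
    case empty
    then show ?case by (simp add: changed_empty)
  next
    case (insert Q X)
    then show ?case
      using odd_card_Int_sym_diff[OF finC[of Y], of "corners Q" "changed X"] corners1[of Q Y] Y
        changed_insert[of Q X] by (auto simp: Int_commute)
  qed
  have "card ?W * card ?W \<le> 2 ^ card V"
  proof (rule card_isotropic[OF finite_V])
    show "?W \<subseteq> Pow V" unfolding changed_def by blast
    show "{} \<in> ?W" by (rule empty_in_image_changed)
    show "even (card (a \<inter> b))" if "a \<in> ?W" "b \<in> ?W" for a b using that ortho by blast
    show "sym_diff a b \<in> ?W" if "a \<in> ?W" "b \<in> ?W" for a b using that by (rule image_changed_closed)
  qed
  moreover have "card {X. neutral X} * card ?W = 2 ^ card ?F"
    by (rule card_neutral_times_card_changed)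
  moreover have "(2::nat) ^ (card V + 4) \<le> 2 ^ (2 * card ?F)"
    using regions_lower_bound by (intro power_increasing) auto
  moreover have "card ?W > 0" by (rule card_changed_pos)
  ultimately have "16 * (card ?W * card ?W) \<le> (card {X. neutral X} * card ?W) ^ 2"
    by (simp add: power_add power_mult[symmetric] mult.commute)
  then have "16 * (card ?W * card ?W) \<le> card {X. neutral X} ^ 2 * (card ?W * card ?W)"
    by (simp add: power2_eq_square algebra_simps)
  then have "4 ^ 2 \<le> card {X. neutral X} ^ 2" using \<open>card ?W > 0\<close> by simp
  then have "4 \<le> card {X. neutral X}" by (rule power2_le_imp_le) simp
  then show ?thesis using card_neutral_le_4 by linarith
qed

section \<open>Counting the classes of states\<close>

definition ones :: "(complex \<Rightarrow> nat) \<Rightarrow> complex set" where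
  "ones s = {v \<in> V. s v = 1}"

lemma bij_betw_ones: "bij_betw ones (states V) (Pow V)"
proof (rule bij_betw_byWitness[where f' = "\<lambda>A v. if v \<in> V then if v \<in> A then 1 else 0 else undefined"])
  show "\<forall>s\<in>states V. (\<lambda>v. if v \<in> V then if v \<in> ones s then 1 else 0 else undefined) = s"
  proof (intro ballI ext)
    fix s v assume s: "s \<in> states V"
    have "s v = 0 \<or> s v = 1" if "v \<in> V" using s that unfolding states_def by (auto dest: PiE_mem)
    moreover have "s v = undefined" if "v \<notin> V" using s that unfolding states_def by (rule PiE_arb)
    ultimately show "(if v \<in> V then if v \<in> ones s then 1 else 0 else undefined) = s v"
      unfolding ones_def by auto
  qed
  show "(\<lambda>A v. if v \<in> V then if v \<in> A then 1 else 0 else undefined) ` Pow V \<subseteq> states V"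
    unfolding states_def by (auto simp: PiE_def extensional_def split: if_splits)
  have "ones (\<lambda>v. if v \<in> V then if v \<in> A then 1 else 0 else undefined) = A" if "A \<subseteq> V" for A
    using that unfolding ones_def by (auto split: if_splits)
  then show "\<forall>A\<in>Pow V. ones (\<lambda>v. if v \<in> V then if v \<in> A then 1 else 0 else undefined) = A"
    by blast
qed (auto simp: ones_def)

lemma ones_crossing_change:
  assumes R: "R \<in> regions V E" and s: "s \<in> states V"
  shows "crossing_change V R s \<in> states V" "ones (crossing_change V R s) = sym_diff (ones s) (corners R)"
proof -
  have s01: "s v = 0 \<or> s v = 1" if "v \<in> V" for v using s that unfolding states_def by (auto dest: PiE_mem)
  show "crossing_change V R s \<in> states V"
    using s s01 unfolding states_def crossing_change_def by (fastforce simp: PiE_def extensional_def)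
  show "ones (crossing_change V R s) = sym_diff (ones s) (corners R)"
    unfolding ones_def crossing_change_def corners_def using s01 by fastforce
qed

text \<open>Crossing changes commute and undo themselves, so their combined effect is given by the set of
  the regions that are used an odd number of times.\<close>

lemma state_equiv_iff:
  "(s, t) \<in> state_equiv V E \<longleftrightarrow>
     s \<in> states V \<and> t \<in> states V \<and> sym_diff (ones s) (ones t) \<in> changed ` Pow (regions V E)"
proof -
  let ?r = "{(a, crossing_change V R a) | a R. R \<in> regions V E}"
  have fwd: "t \<in> states V \<and> (\<exists>X\<subseteq>regions V E. ones t = sym_diff (ones s) (changed X))"
    if s: "s \<in> states V" and st: "(s, t) \<in> ?r\<^sup>*" for s t
    using st
  proof (induction rule: rtrancl_induct)
    case base
    then show ?case using s changed_empty by (intro conjI exI[of _ "{}"]) auto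
  next
    case (step t u)
    then obtain X R where X: "t \<in> states V" "X \<subseteq> regions V E" "ones t = sym_diff (ones s) (changed X)"
      "R \<in> regions V E" "u = crossing_change V R t" by blast
    have "ones u = sym_diff (sym_diff (ones s) (changed X)) (changed {R})"
      using ones_crossing_change(2)[OF X(4,1)] X(3,5) changed_singleton[OF X(4)] by simp
    also have "\<dots> = sym_diff (ones s) (changed (sym_diff X {R}))"
      unfolding changed_sym_diff by blast
    finally show ?case using X ones_crossing_change(1)[OF X(4,1)]
      by (intro conjI exI[of _ "sym_diff X {R}"]) auto
  qed
  have bwd: "\<exists>t\<in>states V. (s, t) \<in> ?r\<^sup>* \<and> ones t = sym_diff (ones s) (changed X)"
    if s: "s \<in> states V" and X: "X \<subseteq> regions V E" for s X
    using finite_subset[OF X finite_regions] X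
  proof (induction X)
    case empty
    then show ?case using s changed_empty by (intro bexI[of _ s]) auto
  next
    case (insert R X)
    then obtain t where t: "t \<in> states V" "(s, t) \<in> ?r\<^sup>*" "ones t = sym_diff (ones s) (changed X)" by blast
    have R: "R \<in> regions V E" using insert.prems by blast
    have "(t, crossing_change V R t) \<in> ?r" using R by blast
    then have "(s, crossing_change V R t) \<in> ?r\<^sup>*" using t(2) by (rule rtrancl_into_rtrancl[rotated])
    moreover have "ones (crossing_change V R t) = sym_diff (ones s) (changed (insert R X))"
      unfolding ones_crossing_change(2)[OF R t(1)] changed_insert[OF R insert.hyps(2)] t(3) by blast
    ultimately show ?case using ones_crossing_change(1)[OF R t(1)] by blast
  qed
  have inj: "s = t" if "s \<in> states V" "t \<in> states V" "ones s = ones t" for s t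
    using bij_betw_ones that unfolding bij_betw_def inj_on_def by blast
  show ?thesis
  proof
    assume "(s, t) \<in> state_equiv V E"
    then have st: "s \<in> states V" "t \<in> states V" "(s, t) \<in> ?r\<^sup>*" unfolding state_equiv_def by auto
    obtain X where "X \<subseteq> regions V E" "ones t = sym_diff (ones s) (changed X)"
      using fwd[OF st(1,3)] by blast
    moreover from this have "sym_diff (ones s) (ones t) = changed X" by blast
    ultimately show "s \<in> states V \<and> t \<in> states V \<and>
        sym_diff (ones s) (ones t) \<in> changed ` Pow (regions V E)" using st by blast
  next
    assume st: "s \<in> states V \<and> t \<in> states V \<and> sym_diff (ones s) (ones t) \<in> changed ` Pow (regions V E)"
    then obtain X where X: "X \<subseteq> regions V E" "sym_diff (ones s) (ones t) = changed X" by auto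
    obtain u where u: "u \<in> states V" "(s, u) \<in> ?r\<^sup>*" "ones u = sym_diff (ones s) (changed X)"
      using bwd[of s X] X(1) st by auto
    have "ones u = ones t" unfolding u(3) X(2)[symmetric] by blast
    then have "u = t" using inj u st by blast
    then show "(s, t) \<in> state_equiv V E" using st u unfolding state_equiv_def by blast
  qed
qed

text \<open>The classes correspond to the cosets of the image of \<open>changed\<close> in the space of all sets of
  vertices.\<close>

lemma num_states_times_card_changed:
  "num_states V E * card (changed ` Pow (regions V E)) = 2 ^ card V"
proof -
  let ?W = "changed ` Pow (regions V E)" and ?r = "state_equiv V E"
  note zero = empty_in_image_changed and closed = image_changed_closed
  have eq: "equiv (states V) ?r"
  proof (rule equivI)
    show "?r \<subseteq> states V \<times> states V" unfolding state_equiv_def by blast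
    show "refl_on (states V) ?r"
      unfolding refl_on_def using zero by (auto simp: state_equiv_iff)
    show "sym ?r" by (rule symI) (auto simp: state_equiv_iff Un_commute)
    show "trans ?r"
    proof (rule transI)
      fix s t u assume a: "(s, t) \<in> ?r" "(t, u) \<in> ?r"
      have "sym_diff (ones s) (ones u) =
          sym_diff (sym_diff (ones s) (ones t)) (sym_diff (ones t) (ones u))" by blast
      then show "(s, u) \<in> ?r" using a closed unfolding state_equiv_iff by metis
    qed
  qed
  have card_class: "card c = card ?W" if c: "c \<in> states V // ?r" for c
  proof -
    obtain s where s: "s \<in> states V" "c = ?r `` {s}" using c by (rule quotientE)
    have WV: "?W \<subseteq> Pow V" unfolding changed_def by blast
    have "ones s \<subseteq> V" unfolding ones_def by blast
    let ?f = "\<lambda>t. sym_diff (ones s) (ones t)"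
    have "bij_betw ?f c ?W"
      unfolding bij_betw_def
    proof
      show "inj_on ?f c"
      proof (rule inj_onI)
        fix t u assume t: "t \<in> c" "u \<in> c" "?f t = ?f u"
        then have "ones t = ones u" by blast
        moreover have "t \<in> states V" "u \<in> states V" using t s(2) by (auto simp: state_equiv_iff)
        ultimately show "t = u" using bij_betw_ones unfolding bij_betw_def inj_on_def by blast
      qed
      show "?f ` c = ?W"
      proof
        show "?f ` c \<subseteq> ?W" 
        proof (rule image_subsetI)
          fix t assume "t \<in> c"
          then have "(s, t) \<in> ?r" using s(2) by blast
          then show "?f t \<in> ?W" unfolding state_equiv_iff by blast
        qed
        show "?W \<subseteq> ?f ` c"
        proof
          fix w assume w: "w \<in> ?W"
          then have "sym_diff (ones s) w \<in> Pow V" using WV \<open>ones s \<subseteq> V\<close> by blast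
          then have "sym_diff (ones s) w \<in> ones ` states V"
            using bij_betw_imp_surj_on[OF bij_betw_ones] by simp
          then obtain t where t: "t \<in> states V" "ones t = sym_diff (ones s) w" by (metis imageE)
          have "?f t = w" unfolding t(2) by blast
          then have "(s, t) \<in> ?r" unfolding state_equiv_iff using s(1) t(1) w by simp
          then have "t \<in> c" unfolding s(2) by simp
          then show "w \<in> ?f ` c" using \<open>?f t = w\<close> by (intro image_eqI[of w ?f t]) simp_all
        qed
      qed
    qed
    then show ?thesis by (rule bij_betw_same_card)
  qed
  have card_states: "card (states V) = 2 ^ card V"
    using bij_betw_same_card[OF bij_betw_ones] finite_V by (simp add: card_Pow)
  then have fin: "finite (states V)" by (metis card.infinite power_eq_0_iff zero_neq_numeral)
  have "card ?W * card (states V // ?r) = card (\<Union>(states V // ?r))"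
  proof (rule card_partition)
    show "finite (states V // ?r)" "finite (\<Union>(states V // ?r))"
      using fin Union_quotient[OF eq] by (auto intro: finite_quotient simp: state_equiv_def)
    show "c1 \<inter> c2 = {}" if "c1 \<in> states V // ?r" "c2 \<in> states V // ?r" "c1 \<noteq> c2" for c1 c2
      using quotient_disj[OF eq that(1,2)] that(3) by blast
  qed (rule card_class)
  then show ?thesis using Union_quotient[OF eq] card_states unfolding num_states_def
    by (simp add: mult.commute)
qed

lemma num_states_eq:
  "real (num_states V E) =
     real (card {X. neutral X}) * 2 powi (int (card V) - int (card (regions V E)))"
proof -
  let ?w = "card (changed ` Pow (regions V E))"
  have N: "real (num_states V E) * real ?w = 2 ^ card V"
    using num_states_times_card_changed by (metis of_nat_mult of_nat_numeral of_nat_power)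
  have K: "real (card {X. neutral X}) * real ?w = 2 ^ card (regions V E)"
    using card_neutral_times_card_changed by (metis of_nat_mult of_nat_numeral of_nat_power)
  have "real (num_states V E) * 2 ^ card (regions V E) = real (card {X. neutral X}) * 2 ^ card V"
    unfolding N[symmetric] K[symmetric] by (rule mult.left_commute)
  then show ?thesis by (simp add: power_int_diff field_simps)
qed

end

section \<open>Colorings of triangles and their monodromy\<close>

inductive_cases induces_NilE: "induces V E v c [] w d"
inductive_cases induces_ConsE: "induces V E v c (e # es) w d"

lemma permutes_fixing_2_iff:
  fixes p :: "nat \<Rightarrow> nat"
  assumes p: "p permutes {1, 2, 3}"
  shows "p 2 = 2 \<longleftrightarrow> p \<in> {id, Transposition.transpose 1 3}"
proof
  assume p2: "p 2 = 2"
  have inj: "p i = p j \<longleftrightarrow> i = j" for i j using permutes_inj[OF p] by (auto dest: injD)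
  have in3: "p i \<in> {1, 2, 3}" if "i \<in> {1, 2, 3}" for i using permutes_in_image[OF p] that by blast
  have p13: "p 1 \<in> {1, 3}" "p 3 \<in> {1, 3}"
    using in3[of 1] in3[of 3] inj[of 1 2] inj[of 3 2] p2 by auto
  have out: "p i = i" if "i \<notin> {1, 2, 3}" for i using p that by (auto simp: permutes_def)
  show "p \<in> {id, Transposition.transpose 1 3}"
  proof (cases "p 1 = 1")
    case True
    then have "p 3 = 3" using p13 inj[of 1 3] by auto
    then have "p i = id i" for i using True p2 out[of i] by (cases "i \<in> {1, 2, 3}") auto
    then show ?thesis by auto
  next
    case False
    then have "p 1 = 3" "p 3 = 1" using p13 inj[of 1 3] by auto
    then have "p i = Transposition.transpose 1 3 i" for i
      using p2 out[of i] by (cases "i \<in> {1, 2, 3}") (auto simp: Transposition.transpose_def)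
    then show ?thesis by auto
  qed
next
  assume "p \<in> {id, Transposition.transpose 1 3}"
  then show "p 2 = 2" by (auto simp: Transposition.transpose_def)
qed

context cubic_plane_graph
begin

lemma triangle_eq: "triangle V E v = around v"
  unfolding triangle_def around_def ..

lemma coloring_values: "triangle_coloring V E v c \<Longrightarrow> R \<in> around v \<Longrightarrow> c R \<in> {1, 2, 3}"
  unfolding triangle_coloring_def triangle_eq by (rule bij_betwE[THEN bspec])

lemma coloring_inj:
  "triangle_coloring V E v c \<Longrightarrow> R \<in> around v \<Longrightarrow> Q \<in> around v \<Longrightarrow> c R = c Q \<Longrightarrow> R = Q"
  unfolding triangle_coloring_def triangle_eq by (auto simp: bij_betw_def dest: inj_onD)

lemma coloring_onto:
  assumes "triangle_coloring V E v c" "k \<in> {1, 2, 3}"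
  obtains R where "R \<in> around v" "c R = k"
  using assms unfolding triangle_coloring_def triangle_eq bij_betw_def by (metis imageE)

lemma third_region:
  assumes "e \<in> E" "v \<in> e \<inter> V"
  obtains A B C where "beside e = {A, B}" "around v = {A, B, C}" "A \<noteq> B" "A \<noteq> C" "B \<noteq> C"
proof -
  obtain A B where AB: "beside e = {A, B}" "A \<noteq> B"
    using card_beside[OF assms(1)] by (meson card_2_iff)
  have sub: "beside e \<subseteq> around v" using beside_subset_around assms by blast
  have "card (around v - beside e) = 1"
    using sub finite_beside[OF assms(1)] card_beside[OF assms(1)] around_structure(1)[of v] assms(2)
    by (simp add: card_Diff_subset)
  then obtain C where C: "around v - beside e = {C}" by (meson card_1_singletonE)
  have "around v = {A, B, C}" using C sub AB(1) by blast
  moreover have "A \<noteq> C" "B \<noteq> C" using C AB(1) by blast+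
  ultimately show ?thesis using that AB by blast
qed

text \<open>The two regions beside the edge keep their colors, and the new region gets the third one.\<close>

lemma coloring_across_edge:
  assumes e: "e \<in> E" "e \<inter> V = {v, x}" and c: "triangle_coloring V E v c"
  shows "\<exists>c'. triangle_coloring V E x c' \<and> (\<forall>R\<in>beside e. c' R = c R)"
proof -
  have "x \<in> e \<inter> V" using e by blast
  then obtain A B C where ABC: "beside e = {A, B}" "around x = {A, B, C}" "A \<noteq> B" "A \<noteq> C" "B \<noteq> C"
    using third_region[OF e(1)] by metis
  have AB: "A \<in> around v" "B \<in> around v" using beside_subset_around[OF e(1), of v] e(2) ABC(1) by auto
  have col: "c A \<in> {1, 2, 3}" "c B \<in> {1, 2, 3}" "c A \<noteq> c B"
    using coloring_values[OF c] coloring_inj[OF c AB] AB ABC(3) by blast+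
  \<comment> \<open>The three colors add up to 6.\<close>
  have "{1, 2, 3} = {c A, c B, 6 - c A - c B} \<and> 6 - c A - c B \<noteq> c A \<and> 6 - c A - c B \<noteq> c B"
    using col by auto
  then obtain k where k: "{1, 2, 3} = {c A, c B, k}" "k \<noteq> c A" "k \<noteq> c B" by blast
  let ?c' = "c(C := k)"
  have "bij_betw ?c' {A, B, C} {c A, c B, k}"
    unfolding bij_betw_def inj_on_def using ABC(3-5) k col by auto
  then have "triangle_coloring V E x ?c'" unfolding triangle_coloring_def triangle_eq ABC(2) k(1) .
  moreover have "\<forall>R\<in>beside e. ?c' R = c R" using ABC by auto
  ultimately show ?thesis by blast
qed

lemma induces_coloring:
  "induces V E v c es w d \<Longrightarrow> triangle_coloring V E v c \<and> triangle_coloring V E w d"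
  by (induction rule: induces.induct) auto

lemma induces_walk: "induces V E v c es w d \<Longrightarrow> walk V E v es w"
  by (induction rule: induces.induct) auto

lemma induces_exists:
  assumes "walk V E v es w" "triangle_coloring V E v c"
  shows "\<exists>d. induces V E v c es w d"
  using assms
proof (induction es arbitrary: v c)
  case Nil
  then have "induces V E v c [] w c" by (auto intro: induces.Nil)
  then show ?case by blast
next
  case (Cons e es)
  then obtain x where x: "e \<in> E" "e \<inter> V = {v, x}" "walk V E x es w" by auto
  obtain c' where c': "triangle_coloring V E x c'" "\<forall>R\<in>beside e. c' R = c R"
    using coloring_across_edge[OF x(1,2) Cons.prems(2)] by blast
  obtain d where "induces V E x c' es w d" using Cons.IH[OF x(3) c'(1)] by blast
  then have "induces V E v c (e # es) w d"
    by (rule induces.Cons[OF x(1,2) Cons.prems(2) c'(1), rotated])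
      (use c'(2) in \<open>auto simp: beside_def\<close>)
  then show ?case by blast
qed

lemma induces_append:
  "induces V E u c es v d \<Longrightarrow> induces V E v d fs w d' \<Longrightarrow> induces V E u c (es @ fs) w d'"
proof (induction rule: induces.induct)
  case (Cons e v x c c' es w d)
  then show ?case by (auto intro: induces.Cons)
qed simp

lemma induces_rev: "induces V E v c es w d \<Longrightarrow> induces V E w d (rev es) v c"
proof (induction rule: induces.induct)
  case (Nil v c)
  then show ?case using induces.Nil by simp
next
  case (Cons e v x c c' es w d)
  have "v \<in> V" using Cons.hyps(2) by blast
  have "induces V E x c' [e] v c"
  proof (rule induces.Cons[OF Cons.hyps(1) _ Cons.hyps(4,3)])
    show "e \<inter> V = {x, v}" using Cons.hyps(2) by blast
    show "induces V E v c [] v c" using \<open>v \<in> V\<close> Cons.hyps(3) by (rule induces.Nil)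
  qed (use Cons.hyps(5) in simp)
  then show ?case using induces_append[OF Cons.IH] by simp
qed

lemma color_of_third:
  assumes "triangle_coloring V E v c" "around v = {A, B, C}" "A \<noteq> C" "B \<noteq> C" "k \<in> {1, 2, 3}"
  shows "c C = k \<longleftrightarrow> c A \<noteq> k \<and> c B \<noteq> k"
proof -
  obtain R where R: "R \<in> around v" "c R = k" using coloring_onto[OF assms(1,5)] .
  have "c A \<noteq> c C" "c B \<noteq> c C"
    using coloring_inj[OF assms(1), of A C] coloring_inj[OF assms(1), of B C] assms(2-4) by blast+
  then show ?thesis using R assms(2) by auto
qed

text \<open>In each step two regions keep their colors, and the third has color \<open>k\<close> exactly if neither of
  the two has.  So where color \<open>k\<close> goes is independent of the other two colors.\<close>

lemma induces_color_class:
  assumes "induces V E v c es w d" "induces V E v c2 es w d2" "k \<in> {1, 2, 3}"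
    "\<And>R. R \<in> around v \<Longrightarrow> c R = k \<longleftrightarrow> c2 R = k" "R \<in> around w"
  shows "d R = k \<longleftrightarrow> d2 R = k"
  using assms
proof (induction arbitrary: c2 rule: induces.induct)
  case (Nil v c)
  then show ?case by (auto elim: induces_NilE)
next
  case (Cons e v x c c' es w d)
  obtain y c2' where y: "e \<inter> V = {v, y}" "triangle_coloring V E y c2'"
    "\<forall>R\<in>beside e. c2' R = c2 R" "induces V E y c2' es w d2"
    using Cons.prems(1) by (rule induces_ConsE) (auto simp: beside_def intro: that)
  have "v \<noteq> x" using no_loop[OF Cons.hyps(1)] Cons.hyps(2) by (metis insert_absorb2)
  then have "y = x" using y(1) Cons.hyps(2) by (metis doubleton_eq_iff)
  have "x \<in> e \<inter> V" using Cons.hyps(2) by blast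
  then obtain A B C where ABC: "beside e = {A, B}" "around x = {A, B, C}" "A \<noteq> B" "A \<noteq> C" "B \<noteq> C"
    using third_region[OF Cons.hyps(1)] by metis
  have same: "c' R = c R" "c2' R = c2 R" "R \<in> around v" if "R \<in> {A, B}" for R
  proof -
    have R: "R \<in> regions V E" "e \<subseteq> frontier R" using that ABC(1) unfolding beside_def by blast+
    show "c' R = c R" "c2' R = c2 R" using Cons.hyps(5)[OF R] y(3) that ABC(1) by auto
    show "R \<in> around v" using R Cons.hyps(2) unfolding around_def by blast
  qed
  have AB: "c' R = k \<longleftrightarrow> c2' R = k" if "R \<in> {A, B}" for R
    using same[OF that] Cons.prems(3) by simp
  have "c' C = k \<longleftrightarrow> c2' C = k"
    using color_of_third[OF Cons.hyps(4) ABC(2,4,5) Cons.prems(2)] AB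
      color_of_third[OF y(2)[unfolded \<open>y = x\<close>] ABC(2,4,5) Cons.prems(2)] by simp
  then have "c' Q = k \<longleftrightarrow> c2' Q = k" if "Q \<in> around x" for Q
    using that AB[of A] AB[of B] ABC(2) by auto
  then show ?case
    using Cons.IH[OF y(4)[unfolded \<open>y = x\<close>] Cons.prems(2)] Cons.prems(4) by blast
qed

text \<open>A nonempty neutral set omits exactly one of the regions around each vertex, and carrying a
  coloring along a walk keeps one color on the omitted regions.\<close>

lemma induces_neutral:
  assumes X: "neutral X" "X \<noteq> {}"
    and "induces V E v c es w d" "\<And>R. R \<in> around v \<Longrightarrow> c R = 2 \<longleftrightarrow> R \<notin> X" "R \<in> around w"
  shows "d R = 2 \<longleftrightarrow> R \<notin> X"
  using assms(3-)
proof (induction rule: induces.induct)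
  case (Cons e v x c c' es w d)
  have x: "x \<in> e \<inter> V" using Cons.hyps(2) by blast
  then obtain A B C where ABC: "beside e = {A, B}" "around x = {A, B, C}" "A \<noteq> B" "A \<noteq> C" "B \<noteq> C"
    using third_region[OF Cons.hyps(1)] by metis
  have AB: "c' R = 2 \<longleftrightarrow> R \<notin> X" if "R \<in> {A, B}" for R
  proof -
    have R: "R \<in> regions V E" "e \<subseteq> frontier R" using that ABC(1) unfolding beside_def by blast+
    moreover have "R \<in> around v" using R Cons.hyps(2) unfolding around_def by blast
    ultimately show ?thesis using Cons.hyps(5)[OF R] Cons.prems(1) by simp
  qed
  have two: "card ({A, B, C} \<inter> X) = 2" using neutral_two_around[OF X, of x] x ABC(2) by simp
  have "C \<notin> X \<longleftrightarrow> A \<in> X \<and> B \<in> X"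
    using two ABC(3-5) by (cases "A \<in> X"; cases "B \<in> X"; cases "C \<in> X") (auto simp: Int_insert_left)
  moreover have "c' C = 2 \<longleftrightarrow> c' A \<noteq> 2 \<and> c' B \<noteq> 2"
    using color_of_third[OF Cons.hyps(4) ABC(2,4,5)] by simp
  ultimately have "c' C = 2 \<longleftrightarrow> C \<notin> X" using AB by simp
  then have "c' Q = 2 \<longleftrightarrow> Q \<notin> X" if "Q \<in> around x" for Q
    using that AB[of A] AB[of B] ABC(2) by auto
  then show ?case using Cons.IH Cons.prems(2) by blast
qed simp

lemma induces_along_region:
  "induces V E v c es w d \<Longrightarrow> set es \<subseteq> {e. R \<in> beside e} \<Longrightarrow> d R = c R"
proof (induction rule: induces.induct)
  case (Cons e v x c c' es w d)
  then have "R \<in> regions V E" "e \<subseteq> frontier R" unfolding beside_def by auto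
  then have "c' R = c R" using Cons.hyps(5) by blast
  then show ?case using Cons by simp
qed simp

text \<open>The final coloring along a closed walk is unique on the base triangle, by comparing it color by
  color.  This makes the permutation in the definition of the monodromy unique.\<close>

lemma coloring_monodromy_spec:
  assumes es: "walk V E v es v" and c: "triangle_coloring V E v c"
  shows "coloring_monodromy V E v c es permutes {1, 2, 3}"
    and "induces V E v c es v d \<Longrightarrow> R \<in> around v \<Longrightarrow> d R = coloring_monodromy V E v c es (c R)"
proof -
  let ?P = "\<lambda>p. p permutes {1, 2, 3} \<and>
        (\<exists>d. induces V E v c es v d \<and> (\<forall>R\<in>triangle V E v. d R = p (c R)))"
  have unique_d: "d1 R = d2 R" if "induces V E v c es v d1" "induces V E v c es v d2" "R \<in> around v"
    for d1 d2 R
  proof -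
    have "d1 R \<in> {1, 2, 3}" using coloring_values induces_coloring that by blast
    from induces_color_class[OF that(1,2) this _ that(3)] show ?thesis by simp
  qed
  obtain d0 where d0: "induces V E v c es v d0" using induces_exists[OF es c] by blast
  have bc: "bij_betw c (around v) {1, 2, 3}" "bij_betw d0 (around v) {1, 2, 3}"
    using c induces_coloring[OF d0] unfolding triangle_coloring_def triangle_eq by auto
  have "\<exists>!p. ?P p"
  proof (rule ex_ex1I)
    let ?q = "d0 \<circ> inv_into (around v) c"
    let ?p = "\<lambda>k. if k \<in> {1, 2, 3} then ?q k else k"
    have "bij_betw ?q {1, 2, 3} {1, 2, 3}"
      by (rule bij_betw_trans[OF bij_betw_inv_into[OF bc(1)] bc(2)])
    then have "bij_betw ?p {1, 2, 3} {1, 2, 3}"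
      by (rule bij_betw_cong[THEN iffD1, rotated]) simp
    then have "?p permutes {1, 2, 3}" by (rule bij_imp_permutes) simp
    moreover have "d0 R = ?p (c R)" if "R \<in> around v" for R
      using that bc(1) coloring_values[OF c that] by (simp add: bij_betw_def inv_into_f_f)
    ultimately show "\<exists>p. ?P p" using d0 unfolding triangle_eq by blast
  next
    fix p q assume p: "?P p" and q: "?P q"
    obtain d1 d2 where d: "induces V E v c es v d1" "\<forall>R\<in>around v. d1 R = p (c R)"
      "induces V E v c es v d2" "\<forall>R\<in>around v. d2 R = q (c R)"
      using p q unfolding triangle_eq by blast
    show "p = q"
    proof
      fix k show "p k = q k"
      proof (cases "k \<in> {1, 2, 3}")
        case True
        then obtain R where "R \<in> around v" "c R = k" using coloring_onto[OF c] by blast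
        then show ?thesis using d unique_d[OF d(1,3)] by metis
      next
        case False
        then show ?thesis using p q by (simp add: permutes_def)
      qed
    qed
  qed
  then have P: "?P (coloring_monodromy V E v c es)"
    unfolding coloring_monodromy_def by (rule theI')
  then show "coloring_monodromy V E v c es permutes {1, 2, 3}" by blast
  show "d R = coloring_monodromy V E v c es (c R)" if "induces V E v c es v d" "R \<in> around v"
    using P unique_d[OF that(1) _ that(2)] that(2) unfolding triangle_eq by metis
qed

lemma monodromy_fixes_color_iff:
  assumes v: "v \<in> V" and c: "triangle_coloring V E v c" and R: "R \<in> around v" "c R = 2"
  shows "coloring_monodromy V E v c ` closed_walks V E v \<subseteq> {id, Transposition.transpose 1 3} \<longleftrightarrow>
    (\<forall>es d. induces V E v c es v d \<longrightarrow> d R = 2)"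
proof -
  have each: "coloring_monodromy V E v c es \<in> {id, Transposition.transpose 1 3} \<longleftrightarrow>
      (\<forall>d. induces V E v c es v d \<longrightarrow> d R = 2)" if es: "walk V E v es v" for es
  proof -
    note spec = coloring_monodromy_spec[OF es c]
    have "d R = coloring_monodromy V E v c es 2" if "induces V E v c es v d" for d
      using spec(2)[OF that R(1)] R(2) by simp
    moreover obtain d where "induces V E v c es v d" using induces_exists[OF es c] by blast
    ultimately show ?thesis using permutes_fixing_2_iff[OF spec(1)] by metis
  qed
  show ?thesis
    unfolding closed_walks_def image_subset_iff mem_Collect_eq Ball_def
    using each induces_walk by meson
qed

text \<open>If every closed walk returns color 2 to \<open>R\<close>, then the regions that receive color 2 along walks
  from \<open>v\<close> form a set \<open>Z\<close> with exactly one member around each vertex.  Here it is used that a region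
  keeps its color while one walks along its connected frontier, so that two members of \<open>Z\<close> around
  the same vertex receive color 2 at that vertex, along two walks that together form a closed
  one.\<close>

lemma neutral_if_monodromy_fixes_color:
  assumes v: "v \<in> V" and c: "triangle_coloring V E v c" and R: "R \<in> around v" "c R = 2"
    and fixes2: "\<And>es d. induces V E v c es v d \<Longrightarrow> d R = 2"
  shows "\<exists>X. neutral X \<and> X \<noteq> {}"
proof -
  define Z where "Z = {Q. \<exists>w es d. w \<in> V \<and> Q \<in> around w \<and> induces V E v c es w d \<and> d Q = 2}"
  have at: "\<exists>es d. induces V E v c es w d \<and> d Q = 2" if Q: "Q \<in> Z" "w \<in> V" "Q \<in> around w" for Q w
  proof -
    obtain u es d where u: "u \<in> V" "Q \<in> around u" "induces V E v c es u d" "d Q = 2"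
      using Q(1) unfolding Z_def by blast
    have Qr: "Q \<in> regions V E" using Q(3) unfolding around_def by blast
    obtain fs where fs: "walk V {e \<in> E. Q \<in> beside e} u fs w"
      using frontier_walk[OF Qr] in_corners_iff[OF Qr] u Q by blast
    then have "walk V E u fs w" by (rule walk_mono) blast
    then obtain d' where d': "induces V E u d fs w d'"
      using induces_exists induces_coloring[OF u(3)] by blast
    then have "d' Q = 2" using induces_along_region[OF d', of Q] walk_edges[OF fs] u(4) by auto
    then show ?thesis using induces_append[OF u(3) d'] by blast
  qed
  have unique: "Q = Q'" if Q: "w \<in> V" "Q \<in> around w" "Q' \<in> around w" "Q \<in> Z" "Q' \<in> Z" for w Q Q'
  proof -
    obtain es d where d: "induces V E v c es w d" "d Q = 2" using at Q by blast
    obtain fs d' where d': "induces V E v c fs w d'" "d' Q' = 2" using at Q by blast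
    have "walk V E w (rev fs) v" using walk_rev[OF induces_walk[OF d'(1)]] .
    then obtain c2 where c2: "induces V E w d (rev fs) v c2"
      using induces_exists induces_coloring[OF d(1)] by blast
    have "c2 R = 2" using fixes2[OF induces_append[OF d(1) c2]] .
    moreover have "triangle_coloring V E v c2" using induces_coloring[OF c2] by blast
    ultimately have same: "c2 P = 2 \<longleftrightarrow> c P = 2" if "P \<in> around v" for P
      using coloring_inj[OF _ that R(1)] c R(2) by metis
    have "induces V E v c2 fs w d" using induces_rev[OF c2] by simp
    from induces_color_class[OF this d'(1), of 2 Q'] same Q(3) d'(2) have "d Q' = 2" by simp
    then show ?thesis using coloring_inj induces_coloring[OF d(1)] Q(2,3) d(2) by metis
  qed
  have one: "\<exists>Q. around w \<inter> Z = {Q}" if w: "w \<in> V" for w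
  proof -
    obtain es where "walk V E v es w" using walk_exists v w by blast
    then obtain d where d: "induces V E v c es w d" using induces_exists c by blast
    then obtain Q where Q: "Q \<in> around w" "d Q = 2"
      using coloring_onto[of w d 2] induces_coloring by auto
    then have "Q \<in> Z" using d w unfolding Z_def by blast
    then show ?thesis using unique[OF w] Q(1) by blast
  qed
  let ?X = "regions V E - Z"
  have two: "card (around w \<inter> ?X) = 2" if w: "w \<in> V" for w
  proof -
    obtain Q where Q: "around w \<inter> Z = {Q}" using one[OF w] by blast
    then have "around w \<inter> ?X = around w - {Q}" unfolding around_def by blast
    moreover have "Q \<in> around w" using Q by blast
    ultimately show ?thesis using around_structure(1)[OF w] finite_around[OF w] by simp
  qed
  have "neutral ?X" unfolding neutral_def changed_def using two by auto
  moreover have "?X \<noteq> {}" using two[OF v] by (metis Int_empty_right card.empty zero_neq_numeral)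
  ultimately show ?thesis by blast
qed

text \<open>Two of the three regions around \<open>v\<close> belong to \<open>X\<close>, and these are even.\<close>

lemma neutral_omits_odd:
  assumes X: "neutral X" "X \<noteq> {}" and v: "v \<in> V" and R: "R \<in> around v" "odd_region E R"
  shows "around v \<inter> X = around v - {R}"
proof (rule card_subset_eq)
  show "finite (around v - {R})" using finite_around[OF v] by simp
  show "around v \<inter> X \<subseteq> around v - {R}" using neutral_members_even[OF X(1)] R(2) by blast
  show "card (around v \<inter> X) = card (around v - {R})"
    using neutral_two_around[OF X v] around_structure(1)[OF v] R(1) finite_around[OF v] by simp
qed

text \<open>Around an end of the shared edge, a nonempty neutral set would omit two regions.\<close>

lemma adjacent_odd_regions_card_neutral:
  assumes "adjacent_odd_regions V E"
  shows "card {X. neutral X} = 1"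
proof -
  obtain R R' e where R: "odd_region E R" "odd_region E R'" "R \<noteq> R'" "e \<in> E"
    "R \<in> beside e" "R' \<in> beside e"
    using assms unfolding adjacent_odd_regions_def adjacent_regions_def beside_def by blast
  obtain v x where "e \<inter> V = {v, x}" using edge_ends[OF R(4)] by metis
  then have v: "v \<in> V" "v \<in> e" by auto
  then have around: "R \<in> around v" "R' \<in> around v" using beside_subset_around[OF R(4)] R(5,6) by auto
  have "X = {}" if "neutral X" for X
  proof (rule ccontr)
    assume "X \<noteq> {}"
    then show False
      using neutral_omits_odd[OF that _ v(1) around(1) R(1)] neutral_members_even[OF that] R(2,3) around(2)
      by blast
  qed
  then have "{X. neutral X} = {{}}" using neutral_empty by blast
  then show ?thesis by simp
qed

text \<open>An odd region is omitted by every neutral set, so it leaves at most one nonempty neutral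
  set; the coloring monodromy decides whether there is one.\<close>

lemma odd_region_card_neutral:
  assumes v: "v \<in> V" and c: "triangle_coloring V E v c" and R: "R \<in> around v" "c R = 2" "odd_region E R"
  shows "card {X. neutral X} =
    (if coloring_monodromy V E v c ` closed_walks V E v \<subseteq> {id, Transposition.transpose 1 3} then 2 else 1)"
proof (cases "\<exists>X. neutral X \<and> X \<noteq> {}")
  case True
  then obtain X where X: "neutral X" "X \<noteq> {}" by blast
  have "Y = X" if "neutral Y" "Y \<noteq> {}" for Y
    using neutral_omits_odd[OF that v R(1,3)] neutral_omits_odd[OF X v R(1,3)]
    by (intro neutral_determined[OF that(1) X(1) v, of R]) blast
  then have "{X. neutral X} = {{}, X}" using X neutral_empty by blast
  then have "card {X. neutral X} = 2" using X(2) by simp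
  moreover have "c Q = 2 \<longleftrightarrow> Q \<notin> X" if "Q \<in> around v" for Q
    using neutral_omits_odd[OF X v R(1,3)] coloring_inj[OF c that R(1)] R(2) that by auto
  then have "d R = 2" if "induces V E v c es v d" for es d
    using induces_neutral[OF X that _ R(1)] neutral_omits_odd[OF X v R(1,3)] R(1) by blast
  ultimately show ?thesis using monodromy_fixes_color_iff[OF v c R(1,2)] by auto
next
  case False
  then have "{X. neutral X} = {{}}" using neutral_empty by blast
  then have "card {X. neutral X} = 1" by simp
  then show ?thesis
    using False neutral_if_monodromy_fixes_color[OF v c R(1,2)] monodromy_fixes_color_iff[OF v c R(1,2)]
    by auto
qed

end

theorem theorem1p3:
  fixes V :: "complex set" and E :: "complex set set" and n m :: nat
    and R\<^sub>1 :: "complex set" and v\<^sub>1 :: complex and c :: "complex set \<Rightarrow> nat"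
  assumes "plane_graph V E"
    and "graph_connected V E"
    and "bridgeless V E"
    and "trivalent V E"
    and "card V = n" and "n \<ge> 4"
    and "card (regions V E) = m"
    and "(\<exists>R\<in>regions V E. odd_region E R) \<Longrightarrow> \<not> adjacent_odd_regions V E \<Longrightarrow>
           monodromy_base V E R\<^sub>1 v\<^sub>1 c"
  shows "real (num_states V E) =
    (if \<forall>R\<in>regions V E. \<not> odd_region E R then 2 powi (int n - int m + 2)
     else if \<not> adjacent_odd_regions V E \<and>
             coloring_monodromy V E v\<^sub>1 c ` closed_walks V E v\<^sub>1 \<subseteq> {id, Transposition.transpose 1 3}
       then 2 powi (int n - int m + 1)
     else 2 powi (int n - int m))"
proof -
  interpret cubic_plane_graph V E by unfold_locales (use assms(1-4) in auto)
  have count: "real (num_states V E) = real (card {X. neutral X}) * 2 powi (int n - int m)"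
    using num_states_eq assms(5,7) by simp
  have pow: "(2::real) powi (k + 1) = 2 * 2 powi k" "(2::real) powi (k + 2) = 4 * 2 powi k" for k
    by (simp_all add: power_int_add)
  show ?thesis
  proof (cases "\<forall>R\<in>regions V E. \<not> odd_region E R")
    case True
    then show ?thesis using count all_even_card_neutral by (simp add: pow)
  next
    case odd: False
    show ?thesis
    proof (cases "adjacent_odd_regions V E")
      case True
      have "card {X. neutral X} = 1" by (rule adjacent_odd_regions_card_neutral[OF True])
      then show ?thesis unfolding if_not_P[OF odd] using count True by simp
    next
      case False
      then have "monodromy_base V E R\<^sub>1 v\<^sub>1 c" using assms(8) odd by blast
      then have base: "v\<^sub>1 \<in> V" "triangle_coloring V E v\<^sub>1 c" "R\<^sub>1 \<in> around v\<^sub>1" "c R\<^sub>1 = 2" "odd_region E R\<^sub>1"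
        unfolding monodromy_base_def around_def by auto
      show ?thesis unfolding if_not_P[OF odd]
        using count False odd_region_card_neutral[OF base] by (simp add: pow)
    qed
  qed
qed

end
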